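(* Let $A\subseteq\mathbb{Z}$ be a finite set of integers. Then the following statements hold. (a) If $S=ba^A\subseteq BS(1,2)$, then $|S^2|\ge 3|S|-2$. Moreover, equality holds if and only if $A$ is an arithmetic progression. (b) If $S=ba^A\subseteq BS(1,3)$, then $|S^2|\ge 4|S|-4$. Moreover, equality holds if and only if one of the following holds: $A=\{0,1,3\}$, or $A=\{0,1,4\}$, or $A=3\ast\{0,\dots,n\}\cup(3\ast\{0,\dots,n\}+1)$ for some integer $n\ge 0$, or $A$ is an affine transform of one of these sets.
   Context: $BS(1,n)=\langle a,b\mid ab=ba^n\rangle$ is the Baumslag-Solitar group. For finite $A\subseteq\mathbb{Z}$, $ba^A=\{ba^x: x\in A\}$. $S^2=\{s_1s_2: s_1,s_2\in S\}$. For a positive integer $r$ and finite $X\subseteq\mathbb{Z}$, $r\ast X=\{rx: x\in X\}$ and $X+1=\{x+1: x\in X\}$. An arithmetic progression is a nonempty finite set $\{u,u+d,\dots,u+(k-1)d\}$, $k\ge1$ (one-element sets are included). An affine transform of $X$ is a set of the form $\{ux+v: x\in X\}$ with $u\neq 0$. $|X|$ denotes the size of a finite set $X$. *)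

theory Defs
  imports "HOL-Algebra.Coset"
begin

section \<open>Groups given by generators and relations\<close>

text \<open>The letter \<open>(g, True)\<close> stands for the generator \<open>g\<close> and \<open>(g, False)\<close> for its formal inverse.
  A relation \<open>u = v\<close> is a pair of words.\<close>

type_synonym 'g word = "('g \<times> bool) list"

inductive word_cong :: "('g word \<times> 'g word) set \<Rightarrow> 'g word \<Rightarrow> 'g word \<Rightarrow> bool"
  for R :: "('g word \<times> 'g word) set" where
  refl: "word_cong R w w"
| sym: "word_cong R u v \<Longrightarrow> word_cong R v u"
| trans: "word_cong R u v \<Longrightarrow> word_cong R v w \<Longrightarrow> word_cong R u w"
| append: "word_cong R u u' \<Longrightarrow> word_cong R v v' \<Longrightarrow> word_cong R (u @ v) (u' @ v')"
| cancel: "word_cong R [(g, e), (g, \<not> e)] []"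
| relation: "(u, v) \<in> R \<Longrightarrow> word_cong R u v"

definition word_class :: "('g word \<times> 'g word) set \<Rightarrow> 'g word \<Rightarrow> 'g word set" where
  "word_class R w = {v. word_cong R w v}"

definition presented_group :: "('g word \<times> 'g word) set \<Rightarrow> 'g word set monoid" where
  "presented_group R =
    \<lparr>carrier = range (word_class R),
     mult = (\<lambda>U V. \<Union>u\<in>U. \<Union>v\<in>V. word_class R (u @ v)),
     one = word_class R []\<rparr>"

lemma word_class_eq_iff: "word_class R u = word_class R v \<longleftrightarrow> word_cong R u v"
proof
  assume "word_class R u = word_class R v"
  then have "word_cong R u w \<longleftrightarrow> word_cong R v w" for w
    unfolding word_class_def by (simp add: set_eq_iff)
  then show "word_cong R u v"
    using word_cong.refl by simp
next
  assume uv: "word_cong R u v"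
  have "word_cong R u w \<longleftrightarrow> word_cong R v w" for w
    using word_cong.trans[OF uv] word_cong.trans[OF word_cong.sym[OF uv]] by (rule iffI[rotated])
  then show "word_class R u = word_class R v"
    unfolding word_class_def by (intro Collect_cong)
qed

lemma carrier_presented_group: "carrier (presented_group R) = range (word_class R)"
  by (simp add: presented_group_def)

lemma one_presented_group: "\<one>\<^bsub>presented_group R\<^esub> = word_class R []"
  by (simp add: presented_group_def)

lemma mult_presented_group:
  "word_class R u \<otimes>\<^bsub>presented_group R\<^esub> word_class R v = word_class R (u @ v)"
proof -
  have eq: "word_class R (u' @ v') = word_class R (u @ v)"
    if "u' \<in> word_class R u" "v' \<in> word_class R v" for u' v'
    unfolding word_class_eq_iff using that[unfolded word_class_def mem_Collect_eq]
    by (rule word_cong.append[OF word_cong.sym word_cong.sym])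
  have nonempty: "word_class R u \<noteq> {}" "word_class R v \<noteq> {}"
    unfolding word_class_def using word_cong.refl by blast+
  have "(\<Union>u'\<in>word_class R u. \<Union>v'\<in>word_class R v. word_class R (u' @ v'))
      = (\<Union>u'\<in>word_class R u. \<Union>v'\<in>word_class R v. word_class R (u @ v))"
    by (intro SUP_cong HOL.refl eq)
  also have "\<dots> = word_class R (u @ v)"
    using nonempty by simp
  finally show ?thesis
    by (simp add: presented_group_def)
qed

lemma word_cong_left_inverse:
  "word_cong R (map (\<lambda>(g, e). (g, \<not> e)) (rev w) @ w) []"
proof (induction w)
  case Nil
  show ?case by (simp add: word_cong.refl)
next
  case (Cons x w)
  obtain g e where x: "x = (g, e)" by (cases x)
  let ?w' = "map (\<lambda>(g, e). (g, \<not> e)) (rev w)"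
  have "word_cong R [(g, \<not> e), (g, e)] []"
    using word_cong.cancel[of R g "\<not> e"] by simp
  then have "word_cong R (?w' @ ([(g, \<not> e), (g, e)] @ w)) (?w' @ ([] @ w))"
    by (intro word_cong.append word_cong.refl)
  then have "word_cong R (map (\<lambda>(g, e). (g, \<not> e)) (rev (x # w)) @ x # w) (?w' @ w)"
    by (simp add: x)
  then show ?case
    by (rule word_cong.trans[OF _ Cons.IH])
qed

lemma group_presented_group: "group (presented_group R)"
proof (rule groupI)
  fix X assume "X \<in> carrier (presented_group R)"
  then obtain w where "X = word_class R w"
    by (auto simp: carrier_presented_group)
  then show "\<exists>Y\<in>carrier (presented_group R). Y \<otimes>\<^bsub>presented_group R\<^esub> X = \<one>\<^bsub>presented_group R\<^esub>"
    using word_cong_left_inverse[of R w]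
    by (auto simp: carrier_presented_group one_presented_group mult_presented_group
        word_class_eq_iff)
qed (auto simp: carrier_presented_group one_presented_group mult_presented_group)


section \<open>The Baumslag-Solitar groups \<open>BS(1,n) = \<langle>a, b | ab = ba\<^sup>n\<rangle>\<close>\<close>

datatype bs_gen = Gen_a | Gen_b

definition bs_relations :: "nat \<Rightarrow> (bs_gen word \<times> bs_gen word) set" where
  "bs_relations n =
    {([(Gen_a, True), (Gen_b, True)], (Gen_b, True) # replicate n (Gen_a, True))}"

definition BS :: "nat \<Rightarrow> bs_gen word set monoid" where
  "BS n = presented_group (bs_relations n)"

definition bs_a :: "nat \<Rightarrow> bs_gen word set" where
  "bs_a n = word_class (bs_relations n) [(Gen_a, True)]"

definition bs_b :: "nat \<Rightarrow> bs_gen word set" where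
  "bs_b n = word_class (bs_relations n) [(Gen_b, True)]"

text \<open>The set \<open>ba\<^sup>A = {ba\<^sup>x : x \<in> A}\<close>, as a subset of \<open>BS(1,n)\<close>.\<close>

definition ba_set :: "nat \<Rightarrow> int set \<Rightarrow> bs_gen word set set" where
  "ba_set n A = {bs_b n \<otimes>\<^bsub>BS n\<^esub> (bs_a n [^]\<^bsub>BS n\<^esub> x) | x. x \<in> A}"

lemma group_BS: "group (BS n)"
  by (simp add: BS_def group_presented_group)

lemma bs_a_closed: "bs_a n \<in> carrier (BS n)"
  by (simp add: BS_def bs_a_def carrier_presented_group)

lemma bs_b_closed: "bs_b n \<in> carrier (BS n)"
  by (simp add: BS_def bs_b_def carrier_presented_group)

lemma BS_relation:
  "bs_a n \<otimes>\<^bsub>BS n\<^esub> bs_b n = bs_b n \<otimes>\<^bsub>BS n\<^esub> (bs_a n [^]\<^bsub>BS n\<^esub> n)"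
proof -
  let ?R = "bs_relations n"
  interpret group "BS n" by (rule group_BS)
  have pow: "bs_a n [^]\<^bsub>BS n\<^esub> k = word_class ?R (replicate k (Gen_a, True))" for k :: nat
  proof (induction k)
    case 0
    show ?case by (simp add: BS_def one_presented_group)
  next
    case (Suc k)
    then have "bs_a n [^]\<^bsub>BS n\<^esub> Suc k
        = word_class ?R (replicate k (Gen_a, True) @ [(Gen_a, True)])"
      by (simp add: BS_def bs_a_def mult_presented_group)
    then show ?case by (simp add: replicate_append_same)
  qed
  have "word_cong ?R [(Gen_a, True), (Gen_b, True)] ((Gen_b, True) # replicate n (Gen_a, True))"
    by (rule word_cong.relation) (simp add: bs_relations_def)
  then show ?thesis
    unfolding pow by (simp add: BS_def bs_a_def bs_b_def mult_presented_group word_class_eq_iff)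
qed

lemma ba_set_subset: "ba_set n A \<subseteq> carrier (BS n)"
proof -
  interpret group "BS n" by (rule group_BS)
  show ?thesis
    by (auto simp: ba_set_def bs_a_closed bs_b_closed)
qed


section \<open>Sets of integers\<close>

text \<open>The difference \<open>d = 0\<close> only yields one-element sets, which count as progressions anyway.\<close>

definition arithmetic_progression :: "int set \<Rightarrow> bool" where
  "arithmetic_progression X \<longleftrightarrow>
    (\<exists>u d. \<exists>k::nat. k \<ge> 1 \<and> X = {u + int i * d | i. i < k})"

definition dilate :: "int \<Rightarrow> int set \<Rightarrow> int set" where
  "dilate r X = {r * x | x. x \<in> X}"

definition translate :: "int set \<Rightarrow> int \<Rightarrow> int set" where
  "translate X c = {x + c | x. x \<in> X}"

definition affine_transform :: "int set \<Rightarrow> int set \<Rightarrow> bool" where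
  "affine_transform X Y \<longleftrightarrow> (\<exists>u v. u \<noteq> 0 \<and> Y = {u * x + v | x. x \<in> X})"

definition extremal_model :: "int set \<Rightarrow> bool" where
  "extremal_model X \<longleftrightarrow>
    X = {0, 1, 3} \<or> X = {0, 1, 4} \<or>
    (\<exists>n::int. n \<ge> 0 \<and> X = dilate 3 {0..n} \<union> translate (dilate 3 {0..n}) 1)"

end

theory Submission
  imports Defs "HOL-Library.Set_Algebras" "HOL.Rat"
begin

text \<open>The relation gives \<open>ba\<^sup>x ba\<^sup>y = b\<^sup>2a\<^bsup>nx+y\<^esup>\<close>, and \<open>a\<close> has infinite order, so
  \<open>|S\<^sup>2| = |A + n \<cdot> A|\<close>. This number is invariant under affine maps, so \<open>A\<close>, if not a
  single point, may be rescaled until it meets at least two residue classes \<open>A\<^sub>i\<close> modulo \<open>n\<close>;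
  then \<open>|A + n \<cdot> A|\<close> is the sum of the \<open>|A\<^sub>i + n \<cdot> A|\<close>. If all \<open>n\<close> classes are nonempty, then \<open>|X + Y| \<ge> |X| + |Y| - 1\<close>
  gives the bound, and equality there forces \<open>Y\<close> to be a progression when \<open>|X| \<ge> 2\<close>.

  The remaining case is \<open>n = 3\<close> and \<open>A = 3 \<cdot> P \<union> (3 \<cdot> Q + e)\<close>, where
  \<open>|A + 3 \<cdot> A| = |P + A| + |Q + A|\<close>. If \<open>P\<close> misses a class modulo 3, then
  \<open>P + 3 \<cdot> Q + e\<close> reaches a class that \<open>P + 3 \<cdot> P\<close> misses, and induction bounds \<open>|P + 3 \<cdot> P|\<close>.
  If \<open>P\<close> meets all three classes, then \<open>|P + A| \<ge> |P| + 3 max(|P|, |Q|) - 3\<close>, which suffices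
  unless \<open>|P| = |Q|\<close>; there one gains 1 more, because in case of equality the sets
  \<open>P\<^sub>i\<^sub>+\<^sub>1 + 3 \<cdot> P\<close> and \<open>P\<^sub>i + 3 \<cdot> Q + e\<close> would coincide for all \<open>i\<close>, and adding up their minima
  would give \<open>3 min P = 3 min Q + e\<close>.\<close>

section \<open>Sumsets of integers\<close>

lemma dilate_eq: "dilate r X = (*) r ` X"
  by (auto simp: dilate_def)

lemma translate_eq: "translate X c = (\<lambda>x. x + c) ` X"
  by (auto simp: translate_def)

lemma finite_dilate [simp]: "finite X \<Longrightarrow> finite (dilate r X)"
  by (simp add: dilate_eq)

lemma finite_translate [simp]: "finite X \<Longrightarrow> finite (translate X c)"
  by (simp add: translate_eq)

lemma dilate_empty [simp]: "dilate r X = {} \<longleftrightarrow> X = {}"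
  by (simp add: dilate_eq)

lemma translate_empty [simp]: "translate X c = {} \<longleftrightarrow> X = {}"
  by (simp add: translate_eq)

lemma card_dilate [simp]: "r \<noteq> 0 \<Longrightarrow> card (dilate r X) = card X"
  unfolding dilate_eq by (intro card_image inj_onI) simp

lemma card_translate [simp]: "card (translate X c) = card X"
  unfolding translate_eq by (intro card_image inj_onI) simp

lemma translate_translate [simp]: "translate (translate X c) d = translate X (c + d)"
  by (auto simp: translate_eq image_image add.assoc)

lemma translate_0 [simp]: "translate X 0 = X"
  by (simp add: translate_eq)

lemma dilate_1 [simp]: "dilate 1 X = X"
  by (simp add: dilate_eq)

lemma dilate_dilate [simp]: "dilate r (dilate s X) = dilate (r * s) X"
  by (auto simp: dilate_eq image_image mult.assoc)

lemma dilate_translate: "dilate r (translate X c) = translate (dilate r X) (r * c)"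
  by (auto simp: dilate_eq translate_eq image_image algebra_simps)

lemma dilate_Un: "dilate r (X \<union> Y) = dilate r X \<union> dilate r Y"
  by (auto simp: dilate_eq)

lemma translate_Un: "translate (X \<union> Y) c = translate X c \<union> translate Y c"
  by (auto simp: translate_eq)

lemma sumset_translate_left: "translate X c + Y = translate (X + Y) (c::int)"
  by (force simp: translate_eq set_plus_def)

lemma sumset_translate_right: "X + translate Y c = translate (X + Y) (c::int)"
  by (force simp: translate_eq set_plus_def)

lemma dilate_sumset: "dilate r (X + Y) = dilate r X + dilate r Y"
  by (force simp: dilate_eq set_plus_def distrib_left)

lemma sumset_singleton_left: "{c} + X = translate X c"
  by (auto simp: set_plus_def translate_def algebra_simps)

lemma sumset_empty_iff [simp]: "X + Y = {} \<longleftrightarrow> X = {} \<or> Y = {}" for X :: "int set"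
  by (auto simp: set_plus_def)

lemma Min_translate:
  assumes "finite X" "X \<noteq> {}"
  shows "Min (translate X c) = Min X + c"
  unfolding translate_eq using assms by (subst mono_Min_commute[symmetric]) (auto simp: mono_def)

lemma Min_dilate:
  assumes "finite X" "X \<noteq> {}" "r \<ge> 0"
  shows "Min (dilate r X) = r * Min X"
  unfolding dilate_eq using assms
  by (subst mono_Min_commute[symmetric]) (auto simp: mono_def mult_left_mono)

lemma Min_sumset:
  assumes "finite X" "X \<noteq> {}" "finite Y" "Y \<noteq> {}"
  shows "Min (X + Y) = Min X + (Min Y :: int)"
proof (rule Min_eqI)
  show "finite (X + Y)"
    using assms by (simp add: finite_set_plus)
  show "Min X + Min Y \<in> X + Y"
    using assms by (intro set_plus_intro) auto
  show "Min X + Min Y \<le> z" if "z \<in> X + Y" for z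
    using that assms by (auto simp: set_plus_def intro!: add_mono)
qed

text \<open>The copies \<open>Min X + Y\<close> and \<open>X + Max Y\<close> inside
  \<open>X + Y\<close> share only the corner \<open>Min X + Max Y\<close>, because
  \<open>y \<le> Max Y\<close> and \<open>Min X \<le> x\<close>. The set \<open>V\<close> is kept
  explicit since equality of sizes later forces \<open>X + Y = V\<close>.\<close>

lemma sumset_two_sides:
  fixes X Y :: "int set"
  assumes "finite X" "X \<noteq> {}" "finite Y" "Y \<noteq> {}"
  defines "V \<equiv> translate Y (Min X) \<union> translate X (Max Y)"
  shows "V \<subseteq> X + Y" and "card V + 1 = card X + card Y"
proof -
  show "V \<subseteq> X + Y"
  proof
    fix z assume "z \<in> V"
    then consider y where "y \<in> Y" "z = Min X + y" | x where "x \<in> X" "z = x + Max Y"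
      by (auto simp: V_def translate_eq)
    then show "z \<in> X + Y"
      using Min_in[OF assms(1,2)] Max_in[OF assms(3,4)] by cases (simp_all add: set_plus_intro)
  qed
  have "translate Y (Min X) \<inter> translate X (Max Y) = {Min X + Max Y}"
  proof -
    have "y + Min X = Min X + Max Y" if "x \<in> X" "y \<in> Y" "y + Min X = x + Max Y" for x y
      using that Min_le[OF assms(1), of x] Max_ge[OF assms(3), of y] by linarith
    then have "translate Y (Min X) \<inter> translate X (Max Y) \<subseteq> {Min X + Max Y}"
      unfolding translate_eq by blast
    moreover have "Min X + Max Y \<in> translate Y (Min X)" "Min X + Max Y \<in> translate X (Max Y)"
      using Min_in[OF assms(1,2)] Max_in[OF assms(3,4)] by (auto simp: translate_eq add.commute)
    ultimately show ?thesis
      by blast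
  qed
  then show "card V + 1 = card X + card Y"
    using card_Un_Int[of "translate Y (Min X)" "translate X (Max Y)"] assms(1-4)
    by (simp add: V_def)
qed

lemma card_sumset_ge:
  fixes X Y :: "int set"
  assumes "finite X" "X \<noteq> {}" "finite Y" "Y \<noteq> {}"
  shows "card X + card Y \<le> card (X + Y) + 1"
  using card_mono[OF finite_set_plus[OF assms(1,3)] sumset_two_sides(1)[OF assms]]
    sumset_two_sides(2)[OF assms] by linarith

section \<open>Progressions and the equality case of the sumset bound\<close>

definition ap :: "int \<Rightarrow> int \<Rightarrow> nat \<Rightarrow> int set" where
  "ap u d k = (\<lambda>i. u + int i * d) ` {..<k}"

lemma card_ap [simp]: "d \<noteq> 0 \<Longrightarrow> card (ap u d k) = k"
  unfolding ap_def by (subst card_image) (auto simp: inj_on_def)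

text \<open>From any element, steps of \<open>d\<close> can only end at \<open>Max Y\<close>. Hence
  all elements are congruent modulo \<open>d\<close>, and the chain that starts at
  \<open>Min Y\<close> runs through all of them.\<close>

lemma step_closed_imp_ap:
  assumes Y: "finite Y" "Y \<noteq> {}" and "d > 0"
    and step: "\<And>y. y \<in> Y \<Longrightarrow> y \<noteq> Max Y \<Longrightarrow> y + d \<in> Y"
  shows "Y = ap (Min Y) d (card Y)"
proof -
  have reach: "\<exists>k. Max Y = y + int k * d \<and> (\<forall>j\<le>k. y + int j * d \<in> Y)" if "y \<in> Y" for y
    using that
  proof (induction "nat (Max Y - y)" arbitrary: y rule: less_induct)
    case less
    show ?case
    proof (cases "y = Max Y")
      case True
      then show ?thesis using less.prems by (intro exI[of _ 0]) auto
    next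
      case False
      then have "y + d \<in> Y" using step less.prems by blast
      moreover have "y < Max Y" using False Max_ge[OF Y(1) less.prems] by linarith
      ultimately obtain k where k: "Max Y = y + d + int k * d"
        "\<And>j. j \<le> k \<Longrightarrow> y + d + int j * d \<in> Y"
        using less.hyps[of "y + d"] \<open>d > 0\<close> by auto
      have "y + int j * d \<in> Y" if "j \<le> Suc k" for j
        using k(2)[of "j - 1"] that less.prems by (cases j) (auto simp: algebra_simps)
      then show ?thesis
        using k(1) by (intro exI[of _ "Suc k"]) (auto simp: algebra_simps)
    qed
  qed
  obtain k where k: "Max Y = Min Y + int k * d" "\<And>j. j \<le> k \<Longrightarrow> Min Y + int j * d \<in> Y"
    using reach[of "Min Y"] Y by auto
  have "Y = ap (Min Y) d (Suc k)"
  proof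
    show "ap (Min Y) d (Suc k) \<subseteq> Y"
      using k(2) by (auto simp: ap_def less_Suc_eq_le)
    show "Y \<subseteq> ap (Min Y) d (Suc k)"
    proof
      fix y assume "y \<in> Y"
      then obtain l where l: "Max Y = y + int l * d" using reach by blast
      have "y \<ge> Min Y" using \<open>y \<in> Y\<close> Y by simp
      then have "int l * d \<le> int k * d" using l k(1) by linarith
      then have "l \<le> k" using \<open>d > 0\<close> by simp
      moreover from this have "y = Min Y + int (k - l) * d"
        using l k(1) by (simp add: of_nat_diff algebra_simps)
      ultimately show "y \<in> ap (Min Y) d (Suc k)"
        by (auto simp: ap_def less_Suc_eq_le intro!: image_eqI[of _ _ "k - l"])
    qed
  qed
  then show ?thesis using \<open>d > 0\<close> card_ap[of d "Min Y" "Suc k"] by simp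
qed

text \<open>Equality turns \<open>X + Y\<close> into the two-sided set of
  \<open>sumset_two_sides\<close>. If \<open>x\<close> is the second smallest element of
  \<open>X\<close>, this forces each \<open>x + y\<close> with \<open>y < Max Y\<close> into
  \<open>Min X + Y\<close>, so \<open>Y\<close> is closed under the step \<open>d\<close> below its
  maximum. As \<open>d\<close> depends on \<open>X\<close> only, all sets that are tight against
  \<open>X\<close> get the same step.\<close>

lemma tight_sumset_imp_ap:
  fixes X :: "int set"
  assumes X: "finite X" "card X \<ge> 2"
  defines "d \<equiv> Min (X - {Min X}) - Min X"
  shows "d > 0"
    and "\<And>Y. finite Y \<Longrightarrow> Y \<noteq> {} \<Longrightarrow> card (X + Y) + 1 = card X + card Y \<Longrightarrow>
      Y = ap (Min Y) d (card Y)"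
proof -
  define x where "x = Min (X - {Min X})"
  have ne: "X \<noteq> {}" "X - {Min X} \<noteq> {}"
    using X card_mono[of "{Min X}" X] by auto
  have x: "x \<in> X" "x \<noteq> Min X" "\<And>z. z \<in> X \<Longrightarrow> z < x \<Longrightarrow> z = Min X"
    using Min_in[OF _ ne(2)] Min_le[of "X - {Min X}"] X(1) by (fastforce simp: x_def)+
  have "Min X \<le> x" using x X by simp
  then show "d > 0" using x(2) by (simp add: d_def x_def)
  fix Y :: "int set"
  assume Y: "finite Y" "Y \<noteq> {}" and tight: "card (X + Y) + 1 = card X + card Y"
  have eq: "X + Y = translate Y (Min X) \<union> translate X (Max Y)"
    using sumset_two_sides[OF X(1) ne(1) Y] tight finite_set_plus[OF X(1) Y(1)]
    by (metis add_right_cancel card_subset_eq)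
  show "Y = ap (Min Y) d (card Y)"
  proof (rule step_closed_imp_ap[OF Y \<open>d > 0\<close>])
    fix y assume y: "y \<in> Y" "y \<noteq> Max Y"
    then have "y < Max Y" using Max_ge[OF Y(1) y(1)] by linarith
    have "x + y \<in> X + Y" using x y by blast
    then consider y' where "y' \<in> Y" "x + y = y' + Min X" | z where "z \<in> X" "x + y = z + Max Y"
      unfolding eq by (auto simp: translate_eq)
    then have "\<exists>y'\<in>Y. x + y = y' + Min X"
    proof cases
      \<comment> \<open>Here \<open>x + y = z + Max Y\<close> and \<open>y < Max Y\<close> give
        \<open>z < x\<close>, and only \<open>Min X\<close> lies below \<open>x\<close> in
        \<open>X\<close>.\<close>
      case 2
      then have "z = Min X" using x(3) \<open>y < Max Y\<close> by simp
      then show ?thesis using 2 Y by (intro bexI[of _ "Max Y"]) auto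
    qed auto
    then obtain y' where "y' \<in> Y" "x + y = y' + Min X" by blast
    moreover from this have "y' = y + d" by (simp add: d_def x_def)
    ultimately show "y + d \<in> Y" by simp
  qed
qed

section \<open>Residue classes\<close>

text \<open>For \<open>e\<close> coprime to \<open>n\<close>, the residue classes modulo \<open>n\<close> are listed in the order
  \<open>0, e, 2e, \<dots>\<close>, so that adding \<open>e\<close> moves every class to its successor.\<close>

definition cls :: "int \<Rightarrow> int \<Rightarrow> int set \<Rightarrow> int \<Rightarrow> int set" where
  "cls n e X i = {x \<in> X. n dvd x - i * e}"

lemma cls_subset: "cls n e X i \<subseteq> X"
  by (auto simp: cls_def)

lemma finite_cls [simp]: "finite X \<Longrightarrow> finite (cls n e X i)"
  by (simp add: cls_def)

lemma cls_Un: "cls n e (X \<union> Y) i = cls n e X i \<union> cls n e Y i"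
  by (auto simp: cls_def)

lemma cls_add_period [simp]: "cls n e X (i + n) = cls n e X i"
proof -
  have "n dvd x - (i + n) * e \<longleftrightarrow> n dvd x - i * e" for x
  proof -
    have "x - i * e = x - (i + n) * e + n * e" by (simp add: algebra_simps)
    then show ?thesis by (metis dvd_add_left_iff dvd_triv_left)
  qed
  then show ?thesis by (simp add: cls_def)
qed

text \<open>Multiples of \<open>n\<close> do not change residues, so a sum lies in the class of its
  left summand. This splits the sumset into pieces with a common right summand.\<close>

lemma cls_sumset_dilate: "cls n e (X + dilate n Y) i = cls n e X i + dilate n Y"
proof -
  have "n dvd x + n * y - i * e \<longleftrightarrow> n dvd x - i * e" for x y
    by (metis add_diff_eq add.commute dvd_add_right_iff dvd_triv_left)
  then show ?thesis
    by (fastforce simp: cls_def set_plus_def dilate_def)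
qed

lemma cls_translate: "cls n e (translate X e) (i + 1) = translate (cls n e X i) e"
  by (auto simp: cls_def translate_def algebra_simps)

lemma card_cls2:
  assumes "finite X"
  shows "card X = card (cls 2 1 X 0) + card (cls 2 1 X 1)"
proof -
  have "X = cls 2 1 X 0 \<union> cls 2 1 X 1" "cls 2 1 X 0 \<inter> cls 2 1 X 1 = {}"
    by (auto simp: cls_def)
  then show ?thesis using assms card_Un_disjoint[of "cls 2 1 X 0" "cls 2 1 X 1"] by simp
qed

lemma Un_cls3:
  assumes "\<not> 3 dvd e"
  shows "X = cls 3 e X i \<union> cls 3 e X (i + 1) \<union> cls 3 e X (i + 2)"
proof -
  have "3 dvd x - i * e \<or> 3 dvd x - (i + 1) * e \<or> 3 dvd x - (i + 2) * e" for x
  proof -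
    define k where "k = x - i * e"
    have "3 dvd k \<or> 3 dvd k - e \<or> 3 dvd k - 2 * e" using assms by presburger
    then show ?thesis by (simp add: k_def algebra_simps)
  qed
  then show ?thesis by (auto simp: cls_def)
qed

lemma three_dvd_mult_iff: "3 dvd a * b \<longleftrightarrow> 3 dvd a \<or> 3 dvd (b::int)"
proof -
  have "a mod 3 = 0 \<or> a mod 3 = 1 \<or> a mod 3 = 2" "b mod 3 = 0 \<or> b mod 3 = 1 \<or> b mod 3 = 2"
    by presburger+
  then show ?thesis
    unfolding dvd_eq_mod_eq_0 mod_mult_eq[of a 3 b, symmetric] by fastforce
qed

lemma disjoint_cls3:
  assumes "\<not> 3 dvd e" "\<not> 3 dvd i - j"
  shows "cls 3 e X i \<inter> cls 3 e X j = {}"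
proof -
  have "3 dvd (i - j) * e" if "3 dvd x - i * e" "3 dvd x - j * e" for x
    using dvd_diff[OF that(2) that(1)] by (simp add: algebra_simps)
  then show ?thesis using assms by (auto simp: cls_def three_dvd_mult_iff)
qed

lemma card_cls3:
  assumes "finite X" "\<not> 3 dvd e"
  shows "card X = card (cls 3 e X i) + card (cls 3 e X (i + 1)) + card (cls 3 e X (i + 2))"
proof -
  let ?X = "cls 3 e X"
  have "card X = card (?X i \<union> ?X (i + 1) \<union> ?X (i + 2))"
    using Un_cls3[OF assms(2)] by metis
  also have "\<dots> = card (?X i \<union> ?X (i + 1)) + card (?X (i + 2))"
    using assms disjoint_cls3[OF assms(2), of i "i + 2" X]
      disjoint_cls3[OF assms(2), of "i + 1" "i + 2" X]
    by (intro card_Un_disjoint) auto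
  also have "card (?X i \<union> ?X (i + 1)) = card (?X i) + card (?X (i + 1))"
    using assms disjoint_cls3[OF assms(2), of i "i + 1" X] by (intro card_Un_disjoint) auto
  finally show ?thesis .
qed

section \<open>Sets that meet all residue classes modulo 3\<close>

definition full3 :: "int set \<Rightarrow> bool" where
  "full3 X \<longleftrightarrow> (\<forall>r. \<exists>x\<in>X. 3 dvd x - r)"

lemma full3_cls: "full3 X \<Longrightarrow> cls 3 e X i \<noteq> {}"
  by (auto simp: full3_def cls_def)

text \<open>In the cyclic order of the classes, some occupied class must be followed by an empty
  one.\<close>

lemma not_full3_cls:
  assumes "\<not> full3 X" "X \<noteq> {}" "\<not> 3 dvd e"
  obtains i where "cls 3 e X i \<noteq> {}" "cls 3 e X (i + 1) = {}"
proof -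
  obtain r where r: "\<not> 3 dvd x - r" if "x \<in> X" for x
    using assms(1) by (auto simp: full3_def)
  \<comment> \<open>Modulo 3 the number \<open>e\<close> is its own inverse, so the residue of
    \<open>r\<close> has index \<open>r * e\<close>.\<close>
  have "3 dvd e * e - 1" using assms(3)
  proof -
    have "3 dvd e - 1 \<or> 3 dvd e + 1" using assms(3) by presburger
    then have "3 dvd (e - 1) * (e + 1)" by auto
    then show ?thesis by (simp add: algebra_simps)
  qed
  have empty: "cls 3 e X (r * e) = {}"
  proof -
    have "3 dvd x - r" if "3 dvd x - r * e * e" for x
    proof -
      have "x - r = (x - r * e * e) + r * (e * e - 1)" by (simp add: algebra_simps)
      then show ?thesis using that \<open>3 dvd e * e - 1\<close> by (metis dvd_add dvd_mult)
    qed
    then show ?thesis using r by (auto simp: cls_def)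
  qed
  have "X = cls 3 e X (r * e + 1) \<union> cls 3 e X (r * e + 1 + 1)"
    using Un_cls3[OF assms(3), of X "r * e"] empty by (simp add: add.assoc)
  moreover have "cls 3 e X (r * e + 1 + 1 + 1) = {}"
    using cls_add_period[of 3 e X "r * e"] empty by (simp add: add.assoc)
  ultimately show thesis using that assms(2) by (metis sup_bot.right_neutral)
qed

lemma full3_card_ge:
  assumes "finite X" "full3 X"
  shows "card X \<ge> 3"
proof -
  have "card (cls 3 1 X i) \<ge> 1" for i
    using full3_cls[OF assms(2)] assms(1) by (simp add: Suc_le_eq card_gt_0_iff)
  from this[of 0] this[of 1] this[of 2] show ?thesis
    using card_cls3[OF assms(1), of 1 0] by simp
qed

text \<open>Each class allows one use of \<open>card_sumset_ge\<close>; the three losses of 1 make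
  up the 3.\<close>

lemma full3_card_sumset:
  assumes "finite X" "full3 X" "finite Y" "Y \<noteq> {}"
  shows "card X + 3 * card Y \<le> card (X + dilate 3 Y) + 3"
proof -
  have "card (cls 3 1 X i) + card Y \<le> card (cls 3 1 (X + dilate 3 Y) i) + 1" for i
    unfolding cls_sumset_dilate
    using card_sumset_ge[of "cls 3 1 X i" "dilate 3 Y"] full3_cls[OF assms(2)] assms by simp
  from this[of 0] this[of 1] this[of 2] show ?thesis
    using card_cls3[of X 1 0, OF assms(1)]
      card_cls3[of "X + dilate 3 Y" 1 0] finite_set_plus[OF assms(1) finite_dilate[OF assms(3)]]
    by simp
qed

section \<open>Extremal sets\<close>

definition extremal :: "int set \<Rightarrow> bool" where
  "extremal A \<longleftrightarrow> (\<exists>B. extremal_model B \<and> affine_transform B A)"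

lemma affine_transform_iff:
  "affine_transform X Y \<longleftrightarrow> (\<exists>u v. u \<noteq> 0 \<and> Y = translate (dilate u X) v)"
  by (simp add: affine_transform_def translate_eq dilate_eq image_image Setcompr_eq_image)

lemma extremalI:
  "extremal_model B \<Longrightarrow> u \<noteq> 0 \<Longrightarrow> A = translate (dilate u B) v \<Longrightarrow> extremal A"
  unfolding extremal_def affine_transform_iff by blast

lemma extremal_model_imp_extremal: "extremal_model A \<Longrightarrow> extremal A"
  by (rule extremalI[of A 1 A 0]) auto

lemma extremal_translate:
  assumes "extremal A"
  shows "extremal (translate A c)"
proof -
  obtain B u v where "extremal_model B" "u \<noteq> 0" "A = translate (dilate u B) v"
    using assms by (auto simp: extremal_def affine_transform_iff)
  then show ?thesis by (intro extremalI[of B u _ "v + c"]) auto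
qed

lemma extremal_dilate:
  assumes "extremal A" "r \<noteq> 0"
  shows "extremal (dilate r A)"
proof -
  obtain B u v where "extremal_model B" "u \<noteq> 0" "A = translate (dilate u B) v"
    using assms by (auto simp: extremal_def affine_transform_iff)
  then show ?thesis
    using assms(2) by (intro extremalI[of B "r * u" _ "r * v"]) (auto simp: dilate_translate)
qed

lemma ap_eq_affine: "ap u d k = translate (dilate d (int ` {..<k})) u"
  by (simp add: ap_def translate_eq dilate_eq image_image algebra_simps)

text \<open>The second term \<open>n * m + d\<close> exists because \<open>k \<ge> 2\<close>. Being
  a multiple of \<open>n\<close>, it shows that \<open>n\<close> divides \<open>d\<close>, and the
  dilation cancels.\<close>

lemma dilate_eq_ap:
  assumes "n \<noteq> 0" "k \<ge> 2" and eq: "dilate n Y = ap (n * m) d k"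
  obtains d' where "d = n * d'" "Y = ap m d' k"
proof -
  have "n * m + int 1 * d \<in> dilate n Y"
    unfolding eq ap_def using assms(2) by (intro imageI) simp
  then obtain y where "n * m + d = n * y" by (auto simp: dilate_def)
  then have d: "d = n * (y - m)" by (simp add: algebra_simps)
  have "dilate n Y = dilate n (ap m (y - m) k)"
    unfolding eq d by (simp add: ap_eq_affine dilate_translate)
  then have "Y = ap m (y - m) k"
    unfolding dilate_eq using assms(1) by (subst (asm) inj_image_eq_iff) (auto simp: inj_on_def)
  with d show thesis by (rule that)
qed

lemma int_image_lessThan: "int ` {..<Suc n} = {0..int n}"
  by (simp add: lessThan_Suc_atMost atMost_atLeast0 image_int_atLeastAtMost)

lemma ap_reverse_subset:
  assumes "k \<ge> 1"
  shows "ap u d k \<subseteq> ap (u + (int k - 1) * d) (- d) k"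
proof
  fix z assume "z \<in> ap u d k"
  then obtain i where i: "i < k" "z = u + int i * d" by (auto simp: ap_def)
  then have "z = u + (int k - 1) * d + int (k - 1 - i) * (- d)"
    by (simp add: of_nat_diff algebra_simps)
  then show "z \<in> ap (u + (int k - 1) * d) (- d) k"
    using i assms unfolding ap_def by (intro image_eqI[of _ _ "k - 1 - i"]) auto
qed

lemma ap_reverse: "k \<ge> 1 \<Longrightarrow> ap u d k = ap (u + (int k - 1) * d) (- d) k"
  using ap_reverse_subset[of k u d] ap_reverse_subset[of k "u + (int k - 1) * d" "- d"] by auto

text \<open>This is the third model with \<open>n = k - 1\<close>, scaled by \<open>d\<close> and
  shifted by \<open>3 * u\<close>. The shift between the two copies has to equal the difference of
  the progression.\<close>

lemma extremal_ap:
  assumes "k \<ge> 1" "d \<noteq> 0"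
  shows "extremal (dilate 3 (ap u d k) \<union> translate (dilate 3 (ap u d k)) d)"
proof -
  obtain n where k: "k = Suc n" using assms(1) by (cases k) auto
  let ?M = "dilate 3 {0..int n} \<union> translate (dilate 3 {0..int n}) 1"
  have "extremal_model ?M"
    unfolding extremal_model_def by (intro disjI2 exI[of _ "int n"]) simp
  moreover have "dilate 3 (ap u d k) \<union> translate (dilate 3 (ap u d k)) d
      = translate (dilate d ?M) (3 * u)"
    unfolding k ap_eq_affine int_image_lessThan
    by (simp add: dilate_translate dilate_Un translate_Un mult.commute add.commute)
  ultimately show ?thesis using assms(2) by (intro extremalI)
qed

lemma extremal_card2:
  assumes "card A = 2"
  shows "extremal A"
proof -
  obtain x y where A: "A = {x, y}" "x \<noteq> y" using assms by (auto simp: card_2_iff)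
  \<comment> \<open>The third family at \<open>n = 0\<close>.\<close>
  have "extremal_model {0, 1}"
    unfolding extremal_model_def
    by (intro disjI2 exI[of _ 0]) (auto simp: dilate_def translate_def)
  then show ?thesis
    using A by (intro extremalI[of "{0, 1}" "y - x" _ x]) (auto simp: dilate_eq translate_eq)
qed

text \<open>Fewer than 9 sums means that two of the nine pairs collide. After translation to
  \<open>{0, g, g + h}\<close> with \<open>g, h > 0\<close>, this happens only if one gap is 2 or 3
  times the other, which gives \<open>{0, 1, 3}\<close>, \<open>{0, 1, 4}\<close> or a
  reflection.\<close>

lemma extremal_card3:
  assumes "card A = 3" "card (A + dilate 3 A) \<noteq> 9"
  shows "extremal A"
proof -
  have ne: "finite A" "A \<noteq> {}" using assms(1) by (auto intro: card_ge_0_finite)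
  define x where "x = Min A"
  have "card (A - {x}) = 2" using assms(1) ne by (simp add: x_def)
  then obtain y z where yz: "A - {x} = {y, z}" "y \<noteq> z" by (auto simp: card_2_iff)
  obtain y z where yz: "A - {x} = {y, z}" "y < z"
    by (metis yz insert_commute linorder_neqE)
  have "x < y" using yz ne x_def Min_le[of A y] by (force simp: order_le_less)
  define g h where "g = y - x" and "h = z - y"
  have gh: "g > 0" "h > 0" using \<open>x < y\<close> yz(2) by (auto simp: g_def h_def)
  have "x \<in> A" using ne by (simp add: x_def)
  then have "A = {x, y, z}" using yz(1) by blast
  then have A: "A = translate {0, g, g + h} x"
    by (simp add: translate_eq g_def h_def)
  let ?B = "{0, g, g + h}"
  have "A + dilate 3 A = translate (?B + dilate 3 ?B) (3 * x + x)"
    unfolding A by (simp add: dilate_translate sumset_translate_left sumset_translate_right)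
  moreover have "?B + dilate 3 ?B = set [0, 3 * g, 3 * g + 3 * h, g, 4 * g, 4 * g + 3 * h,
      g + h, 4 * g + h, 4 * g + 4 * h]"
    by (auto simp: set_plus_def dilate_eq)
  ultimately have "\<not> distinct [0, 3 * g, 3 * g + 3 * h, g, 4 * g, 4 * g + 3 * h,
      g + h, 4 * g + h, 4 * g + 4 * h]"
    using assms(2) distinct_card by fastforce
  then have "h = 2 * g \<or> h = 3 * g \<or> g = 3 * h \<or> g = 2 * h"
    using gh by auto
  then have "\<exists>B u v. extremal_model B \<and> u \<noteq> 0 \<and> ?B = translate (dilate u B) v"
  proof (elim disjE)
    assume "h = 2 * g"
    then show ?thesis using gh
      by (intro exI[of _ "{0, 1, 3}"] exI[of _ g] exI[of _ 0])
        (auto simp: extremal_model_def dilate_eq)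
  next
    assume "h = 3 * g"
    then show ?thesis using gh
      by (intro exI[of _ "{0, 1, 4}"] exI[of _ g] exI[of _ 0])
        (auto simp: extremal_model_def dilate_eq)
  next
    assume "g = 3 * h"
    then show ?thesis using gh
      by (intro exI[of _ "{0, 1, 4}"] exI[of _ "- h"] exI[of _ "4 * h"])
        (auto simp: extremal_model_def dilate_eq translate_eq)
  next
    assume "g = 2 * h"
    then show ?thesis using gh
      by (intro exI[of _ "{0, 1, 3}"] exI[of _ "- h"] exI[of _ "3 * h"])
        (auto simp: extremal_model_def dilate_eq translate_eq)
  qed
  then show ?thesis
    unfolding A by (metis extremalI extremal_translate)
qed

section \<open>Sets meeting exactly two residue classes modulo 3\<close>

text \<open>Up to translation, every finite set that meets exactly two classes modulo 3 is the set
  \<open>A\<close> below.\<close>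

locale two_classes =
  fixes P Q :: "int set" and e :: int
  assumes finP: "finite P" and neP: "P \<noteq> {}" and finQ: "finite Q" and neQ: "Q \<noteq> {}"
    and e: "\<not> 3 dvd e"
begin

definition A :: "int set" where
  "A = dilate 3 P \<union> translate (dilate 3 Q) e"

lemma finA: "finite A"
  by (simp add: A_def finP finQ)

lemma disjoint: "dilate 3 X \<inter> translate (dilate 3 Y) e = {}"
proof -
  have "3 * x \<noteq> 3 * y + e" for x y using e by presburger
  then show ?thesis by (auto simp: dilate_def translate_def)
qed

lemma card_A: "card A = card P + card Q"
  unfolding A_def using disjoint[of P Q] finP finQ by (subst card_Un_disjoint) auto

text \<open>Only the left summand is split by residue, so the two pieces are copies of
  \<open>P + A\<close> and \<open>Q + A\<close> in different classes.\<close>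

lemma card_sumset_A: "card (A + dilate 3 A) = card (P + A) + card (Q + A)"
proof -
  have "A + dilate 3 A = dilate 3 (P + A) \<union> translate (dilate 3 (Q + A)) e"
    by (subst (1) A_def) (simp add: Un_set_plus dilate_sumset sumset_translate_left)
  then show ?thesis
    using disjoint[of "P + A" "Q + A"] finP finQ finA
    by (simp add: card_Un_disjoint finite_set_plus)
qed

section \<open>The residue classes of \<open>P + A\<close>\<close>

lemma PA_eq: "P + A = (P + dilate 3 P) \<union> translate (P + dilate 3 Q) e"
  by (simp add: A_def set_plus_Un sumset_translate_right)

lemma fin_PA: "finite (P + A)"
  by (simp add: finP finA finite_set_plus)

abbreviation "Pc \<equiv> cls 3 e P"

abbreviation "Tc \<equiv> cls 3 e (P + A)"

text \<open>The shift by \<open>e\<close> moves each class to its successor, so a class of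
  \<open>P + A\<close> is fed by two consecutive classes of \<open>P\<close>, one through
  \<open>P\<close> and one through \<open>Q\<close>.\<close>

lemma Tc_Suc: "Tc (i + 1) = (Pc (i + 1) + dilate 3 P) \<union> translate (Pc i + dilate 3 Q) e"
  unfolding PA_eq cls_Un cls_translate cls_sumset_dilate ..

lemma Tc_left: "Pc i + dilate 3 P \<subseteq> Tc i"
  using Tc_Suc[of "i - 1"] by simp

lemma Tc_right: "translate (Pc i + dilate 3 Q) e \<subseteq> Tc (i + 1)"
  by (simp add: Tc_Suc)

lemma card_left: "Pc i \<noteq> {} \<Longrightarrow> card (Pc i) + card P \<le> card (Pc i + dilate 3 P) + 1"
  using card_sumset_ge[of "Pc i" "dilate 3 P"] finP neP by simp

lemma card_right: "Pc i \<noteq> {} \<Longrightarrow> card (Pc i) + card Q \<le> card (Pc i + dilate 3 Q) + 1"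
  using card_sumset_ge[of "Pc i" "dilate 3 Q"] finP finQ neQ by simp

lemma card_Tc_left: "card (Pc i + dilate 3 P) \<le> card (Tc i)"
  by (intro card_mono Tc_left) (simp add: fin_PA)

lemma card_Tc_right: "card (Pc i + dilate 3 Q) \<le> card (Tc (i + 1))"
  using card_mono[OF _ Tc_right] by (simp add: fin_PA)

lemmas card_T = card_cls3[OF fin_PA e] and card_P = card_cls3[OF finP e]

section \<open>Lower bounds when \<open>P\<close> misses a class\<close>

lemma singleton_bound:
  assumes "card P = 1"
  shows "card (P + A) = card P + card Q"
proof -
  obtain x where "P = {x}" using assms by (auto simp: card_1_singleton_iff)
  then have "card (P + A) = card A" by (simp add: sumset_singleton_left)
  then show ?thesis by (simp add: card_A)
qed

text \<open>Class \<open>i + 1\<close> is empty in \<open>P + dilate 3 P\<close> but contains the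
  shifted copy of \<open>Pc i + dilate 3 Q\<close>, so the two sets are disjoint and their sizes
  add.\<close>

lemma nonfull_class:
  assumes "Pc i \<noteq> {}" "Pc (i + 1) = {}"
  shows "card (P + dilate 3 P) + card (Pc i) + card Q \<le> card (P + A) + 1"
proof -
  let ?B = "P + dilate 3 P" and ?C = "translate (Pc i + dilate 3 Q) e"
  have "cls 3 e ?B (i + 1) = {}" using assms(2) by (simp add: cls_sumset_dilate)
  moreover have "?C \<subseteq> cls 3 e (P + A) (i + 1)" by (rule Tc_right)
  ultimately have "?B \<inter> ?C = {}" unfolding cls_def by blast
  moreover have "?B \<union> ?C \<subseteq> P + A"
    using Tc_right[of i] cls_subset[of 3 e "P + A" "i + 1"] by (auto simp: PA_eq)
  ultimately have "card ?B + card ?C \<le> card (P + A)"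
    using card_mono[OF fin_PA, of "?B \<union> ?C"] finP finQ
    by (simp add: card_Un_disjoint finite_set_plus)
  then show ?thesis using card_right[OF assms(1)] by simp
qed

lemma nonfull_bound:
  assumes "\<not> full3 P"
  shows "card (P + dilate 3 P) + card Q \<le> card (P + A)"
proof -
  obtain i where i: "Pc i \<noteq> {}" "Pc (i + 1) = {}"
    using not_full3_cls[OF assms neP e] by blast
  moreover have "card (Pc i) \<ge> 1" using i finP by (simp add: Suc_le_eq card_gt_0_iff)
  ultimately show ?thesis using nonfull_class[OF i] by simp
qed

text \<open>If both points share a residue, \<open>nonfull_class\<close> gives
  \<open>4 + 2 + |Q| - 1\<close>. Otherwise they lie in consecutive classes, and the three classes
  of \<open>P + A\<close> contain a translate of the displayed union, a copy of \<open>3 * Q\<close>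
  and a copy of \<open>3 * P\<close>. A union of minimal size will make its two parts
  coincide.\<close>

lemma pair_bound:
  assumes "card P = 2" "card (P + dilate 3 P) \<ge> 4"
  shows "card Q + 5 \<le> card (P + A) \<or>
    (\<exists>x w. w \<noteq> 0 \<and> P = {x, x + w} \<and>
      card Q + 2 + card (translate (dilate 3 P) w \<union> translate (dilate 3 Q) e) \<le> card (P + A))"
proof -
  have "\<not> full3 P" using full3_card_ge[OF finP] assms(1) by auto
  then obtain i where i: "Pc i \<noteq> {}" "Pc (i + 1) = {}"
    using not_full3_cls[OF _ neP e] by blast
  have sum: "card (Pc i) + card (Pc (i + 2)) = 2"
    using card_P[of i] i(2) assms(1) by simp
  have "card (Pc i) \<ge> 1" using i finP by (simp add: Suc_le_eq card_gt_0_iff)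
  then consider "card (Pc i) = 2" | "card (Pc i) = 1" "card (Pc (i + 2)) = 1"
    using sum by linarith
  then show ?thesis
  proof cases
    case 1
    then show ?thesis using nonfull_class[OF i] assms(2) by simp
  next
    case 2
    then obtain y x where xy: "Pc i = {y}" "Pc (i + 2) = {x}"
      by (auto simp: card_1_singleton_iff)
    have P: "P = {x, y}" using Un_cls3[OF e, of P i] xy i(2) by auto
    have "x \<noteq> y" using P assms(1) by auto
    let ?U = "translate (dilate 3 P) (y - x) \<union> translate (dilate 3 Q) e"
    have period: "cls 3 e X (i + 2 + 1) = cls 3 e X i" for X
      using cls_add_period[of 3 e X i] by (simp add: add.assoc)
    have "Tc i = translate (dilate 3 P) y \<union> translate (dilate 3 Q) (x + e)"
      using Tc_Suc[of "i + 2"] unfolding period xy by (simp add: sumset_singleton_left)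
    also have "\<dots> = translate ?U x"
      by (simp add: translate_Un add.commute)
    finally have "card ?U = card (Tc i)" by simp
    moreover have "card Q \<le> card (Tc (i + 1))"
      using card_Tc_right[of i] xy by (simp add: sumset_singleton_left)
    moreover have "2 \<le> card (Tc (i + 2))"
      using card_Tc_left[of "i + 2"] xy assms(1) by (simp add: sumset_singleton_left)
    ultimately have "card Q + 2 + card ?U \<le> card (P + A)"
      using card_T[of i] by simp
    then show ?thesis
      using P \<open>x \<noteq> y\<close> by (intro disjI2 exI[of _ x] exI[of _ "y - x"]) simp
  qed
qed

section \<open>Bounds and equality when \<open>P\<close> meets all classes\<close>

lemma full_bound:
  assumes "full3 P"
  shows "4 * card P \<le> card (P + A) + 3" "card P + 3 * card Q \<le> card (P + A) + 3"
proof -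
  have "card (P + dilate 3 P) \<le> card (P + A)"
    by (intro card_mono fin_PA) (simp add: PA_eq)
  then show "4 * card P \<le> card (P + A) + 3"
    using full3_card_sumset[OF finP assms finP neP] by simp
  have "card (translate (P + dilate 3 Q) e) \<le> card (P + A)"
    by (intro card_mono fin_PA) (simp add: PA_eq)
  then show "card P + 3 * card Q \<le> card (P + A) + 3"
    using full3_card_sumset[OF finP assms finQ neQ] by simp
qed

text \<open>If both lower bounds for one class of \<open>P + A\<close> are attained, each source
  fills the whole class, so the sources coincide. Comparing their minima gives the linear
  relation.\<close>

lemma tight_class:
  assumes "full3 P" "card P = card Q"
    and "card (Tc (i + 1)) + 1 = card (Pc i) + card P"
    and "card (Tc (i + 1)) + 1 = card (Pc (i + 1)) + card P"
  shows "Pc (i + 1) + dilate 3 P = translate (Pc i + dilate 3 Q) e"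
    and "Min (Pc (i + 1)) + 3 * Min P = Min (Pc i) + 3 * Min Q + e"
proof -
  note ne = full3_cls[OF assms(1), of e]
  have fin: "finite (Tc (i + 1))" by (simp add: fin_PA)
  have "Pc (i + 1) + dilate 3 P = Tc (i + 1)"
    using card_left[OF ne, of "i + 1"] card_Tc_left[of "i + 1"] assms(4)
    by (intro card_subset_eq[OF fin Tc_left]) simp
  moreover have "translate (Pc i + dilate 3 Q) e = Tc (i + 1)"
    using card_right[OF ne, of i] card_Tc_right[of i] assms(2,3)
    by (intro card_subset_eq[OF fin Tc_right]) simp
  ultimately show eq: "Pc (i + 1) + dilate 3 P = translate (Pc i + dilate 3 Q) e" by simp
  have "Min (Pc (i + 1) + dilate 3 P) = Min (translate (Pc i + dilate 3 Q) e)"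
    by (simp only: eq)
  then show "Min (Pc (i + 1)) + 3 * Min P = Min (Pc i) + 3 * Min Q + e"
    using ne finP neP finQ neQ
    by (simp add: Min_sumset Min_translate Min_dilate finite_set_plus)
qed

lemma full_strict:
  assumes full: "full3 P" and eq: "card P = card Q"
  shows "4 * card P \<le> card (P + A) + 2"
proof (rule ccontr)
  assume "\<not> ?thesis"
  then have less: "card (P + A) + 3 \<le> 4 * card P" by simp
  note ne = full3_cls[OF full, of e]
  have l: "card (Pc i) + card P \<le> card (Tc i) + 1" for i
    using card_left[OF ne, of i] card_Tc_left[of i] by simp
  have r: "card (Pc i) + card P \<le> card (Tc (i + 1)) + 1" for i
    using card_right[OF ne, of i] card_Tc_right[of i] eq by simp
  have period: "cls 3 e X 3 = cls 3 e X 0" for X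
    using cls_add_period[of 3 e X 0] by simp
  note sums = card_T[of 0, simplified] card_P[of 0, simplified]
    l[of 0] l[of 1] l[of 2] r[of 0, simplified] r[of 1, simplified] r[of 2, simplified]
  \<comment> \<open>Summed over the three classes, \<open>l\<close> and \<open>r\<close> each give
    \<open>4 * |P| \<le> |P + A| + 3\<close>, so all six estimates are equalities.\<close>
  have t: "card (Tc i) + 1 = card (Pc i) + card P" if "i \<in> {0, 1, 2}" for i
    using that sums less by (auto simp: period)
  have u: "card (Tc (i + 1)) + 1 = card (Pc i) + card P" if "i \<in> {0, 1, 2}" for i
    using that sums less by (auto simp: period)
  have "Min (Pc (i + 1)) + 3 * Min P = Min (Pc i) + 3 * Min Q + e" if "i \<in> {0, 1, 2}" for i
  proof (rule tight_class(2)[OF full eq])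
    show "card (Tc (i + 1)) + 1 = card (Pc i) + card P" by (rule u[OF that])
    show "card (Tc (i + 1)) + 1 = card (Pc (i + 1)) + card P"
      using that t[of 0] t[of 1] t[of 2] by (auto simp: period)
  qed
  \<comment> \<open>The minima of the three classes cancel cyclically, and a factor 3 is divided
    out.\<close>
  from this[of 0] this[of 1] this[of 2] have "3 * Min P = 3 * Min Q + e"
    by (simp add: period)
  then show False using e by presburger
qed

text \<open>Both \<open>l\<close> and \<open>r\<close> now have total slack 1 over the three
  classes. Enough classes stay tight to make \<open>P\<close> a progression and to make
  \<open>3 * Q + e\<close> a translate of \<open>3 * P\<close>; it remains to match the shift with
  the difference.\<close>

lemma full_tight_imp_translate:
  assumes full: "full3 P" and eq: "card P = card Q" and tight: "4 * card P = card (P + A) + 2"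
  shows "\<exists>u d w. \<bar>w\<bar> = d \<and> P = ap u d (card P) \<and>
    translate (dilate 3 Q) e = translate (dilate 3 P) w"
proof -
  note ne = full3_cls[OF full, of e]
  have l: "card (Pc i) + card P \<le> card (Tc i) + 1" for i
    using card_left[OF ne, of i] card_Tc_left[of i] by simp
  have r: "card (Pc i) + card P \<le> card (Tc (i + 1)) + 1" for i
    using card_right[OF ne, of i] card_Tc_right[of i] eq by simp
  have pos: "card (Pc i) \<ge> 1" for i using ne finP by (simp add: Suc_le_eq card_gt_0_iff)
  have period: "cls 3 e X 3 = cls 3 e X 0" "cls 3 e X 4 = cls 3 e X 1" for X
    using cls_add_period[of 3 e X 0] cls_add_period[of 3 e X 1] by simp_all
  note sums = card_T[of 0, simplified] card_P[of 0, simplified]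
    l[of 0] l[of 1] l[of 2] r[of 0, simplified] r[of 1, simplified]
    r[of 2, simplified, unfolded period] pos[of 0] pos[of 1] pos[of 2] tight
  show ?thesis
  proof (cases "card P = 3")
    case True
    have one: "card (Pc i) = 1" if "i \<in> {0, 1, 2}" for i
      using that sums True by auto
    \<comment> \<open>The 10 elements of \<open>P + A\<close> are spread over three classes of size
      at least 3, so two classes have size 3; \<open>i\<close> is chosen to make them
      \<open>i + 1\<close> and \<open>i + 2\<close>.\<close>
    have "\<exists>i\<in>{0, 1, 2}. card (Tc (i + 1)) = 3 \<and> card (Tc (i + 2)) = 3"
      using sums True one[of 0] one[of 1] one[of 2] by (simp add: period) linarith
    then obtain i where i: "i \<in> {0, 1, 2}" "card (Tc (i + 1)) = 3" "card (Tc (i + 2)) = 3"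
      by blast
    have one': "card (Pc i) = 1" "card (Pc (i + 1)) = 1" "card (Pc (i + 2)) = 1"
      using i(1) one[of 0] one[of 1] one[of 2] by (auto simp: period)
    then obtain x y z where xyz: "Pc i = {x}" "Pc (i + 1) = {y}" "Pc (i + 2) = {z}"
      by (auto simp: card_1_singleton_iff)
    have 1: "translate (dilate 3 P) y = translate (dilate 3 Q) (x + e)"
      "y + 3 * Min P = x + 3 * Min Q + e"
      using tight_class[OF full eq, of i] i(2) one' xyz True by (simp_all add: sumset_singleton_left)
    have 2: "z + 3 * Min P = y + 3 * Min Q + e"
      using tight_class(2)[OF full eq, of "i + 1"] i(3) one' xyz True by (simp add: add.assoc)
    define w where "w = y - x"
    have yz: "y = x + w" "z = x + 2 * w" using 1 2 by (simp_all add: w_def)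
    have "translate (dilate 3 Q) e = translate (translate (dilate 3 Q) (x + e)) (- x)" by simp
    also have "\<dots> = translate (dilate 3 P) w" unfolding 1(1)[symmetric] by (simp add: w_def)
    finally have Q: "translate (dilate 3 Q) e = translate (dilate 3 P) w" .
    have "P = {x, x + w, x + 2 * w}"
      using Un_cls3[OF e, of P i] xyz yz by auto
    also have "\<dots> = ap x w 3"
      by (auto simp: ap_def numeral_3_eq_3 lessThan_Suc)
    finally have P: "P = ap x w 3" .
    moreover have "ap x w 3 = ap (x + 2 * w) (- w) 3"
      using ap_reverse[of 3 x w] by simp
    ultimately have "P = ap (if w \<ge> 0 then x else x + 2 * w) \<bar>w\<bar> 3"
      by (simp add: abs_if)
    with Q True show ?thesis by metis
  next
    case False
    \<comment> \<open>As \<open>|P| > 3\<close>, some class with at least two elements is tight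
      against \<open>3 * P\<close> and \<open>3 * Q\<close> at once. Both dilates are then
      progressions with the same difference and length.\<close>
    have "\<exists>i\<in>{0, 1, 2}. card (Pc i) \<ge> 2 \<and> card (Tc i) + 1 = card (Pc i) + card P \<and>
        card (Tc (i + 1)) + 1 = card (Pc i) + card P"
      using sums False by (simp add: period) linarith
    then obtain i where i: "card (Pc i) \<ge> 2" "card (Tc i) + 1 = card (Pc i) + card P"
      "card (Tc (i + 1)) + 1 = card (Pc i) + card P"
      by blast
    define d where "d = Min (Pc i - {Min (Pc i)}) - Min (Pc i)"
    note X = tight_sumset_imp_ap[of "Pc i", folded d_def, OF finite_cls[OF finP] i(1)]
    have "d > 0" by (rule X(1))
    have P: "dilate 3 P = ap (3 * Min P) d (card P)"
      using X(2)[of "dilate 3 P"] finP neP card_left[OF ne, of i] card_Tc_left[of i] i(2)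
      by (simp add: Min_dilate)
    have Q: "dilate 3 Q = ap (3 * Min Q) d (card P)"
      using X(2)[of "dilate 3 Q"] finQ neQ card_right[OF ne, of i] card_Tc_right[of i] i(3) eq
      by (simp add: Min_dilate)
    define w where "w = 3 * Min Q + e - 3 * Min P"
    have w: "translate (dilate 3 Q) e = translate (dilate 3 P) w"
      unfolding P Q by (simp add: ap_eq_affine w_def)
    have "w \<noteq> 0" unfolding w_def using e by presburger
    have "card P \<ge> 2" using full3_card_ge[OF finP full] by simp
    then obtain d' where d': "d = 3 * d'" and P': "P = ap (Min P) d' (card P)"
      using dilate_eq_ap[OF _ _ P] by auto
    have "d' > 0" using \<open>d > 0\<close> d' by simp
    \<comment> \<open>Now \<open>P + A\<close> is the sumset of \<open>{0, w}\<close> and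
      \<open>B\<close>, and its size makes this pair tight as well. So \<open>B\<close> is a
      progression with difference \<open>\<bar>w\<bar>\<close>.\<close>
    define B where "B = P + dilate 3 P"
    have B: "finite B" "B \<noteq> {}" "Min B = 4 * Min P"
      using finP neP by (simp_all add: B_def finite_set_plus Min_sumset Min_dilate)
    have "translate (P + dilate 3 Q) e = P + translate (dilate 3 Q) e"
      by (simp add: sumset_translate_right)
    then have "P + A = B \<union> translate B w"
      unfolding PA_eq w by (simp add: B_def sumset_translate_right)
    also have "\<dots> = {0, w} + B"
      by (auto simp: set_plus_def translate_def algebra_simps)
    finally have PA: "P + A = {0, w} + B" .
    have "card B + 3 \<ge> 4 * card P"
      using full3_card_sumset[OF finP full finP neP] by (simp add: B_def)
    moreover have "2 + card B \<le> card ({0, w} + B) + 1"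
      using card_sumset_ge[of "{0, w}" B] B \<open>w \<noteq> 0\<close> by simp
    ultimately have "card ({0, w} + B) + 1 = card {0, w} + card B" "card B + 3 = 4 * card P"
      using tight PA \<open>w \<noteq> 0\<close> by simp_all
    moreover have "Min ({0, w} - {Min {0, w}}) - Min {0, w} = \<bar>w\<bar>"
      using \<open>w \<noteq> 0\<close> by (cases "w > 0") (auto simp: min_def insert_Diff_if)
    ultimately have Bw: "B = ap (4 * Min P) \<bar>w\<bar> (card B)"
      using tight_sumset_imp_ap(2)[of "{0, w}" B] B \<open>w \<noteq> 0\<close> by simp
    have "card B \<ge> 2" using \<open>card B + 3 = 4 * card P\<close> \<open>card P \<ge> 2\<close> by simp
    \<comment> \<open>Comparing \<open>B\<close> as a progression with \<open>B = P + 3 * P\<close>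
      shows that \<open>\<bar>w\<bar>\<close> and \<open>d'\<close> divide each other.\<close>
    have "Min P + int 1 * d' \<in> P"
      using \<open>card P \<ge> 2\<close> by (subst P') (auto simp: ap_def)
    moreover have "3 * Min P \<in> dilate 3 P" using finP neP by (auto simp: dilate_def)
    ultimately have "(Min P + int 1 * d') + 3 * Min P \<in> B" unfolding B_def by (rule set_plus_intro)
    then have "\<bar>w\<bar> dvd d'" by (subst (asm) Bw) (auto simp: ap_def)
    have "4 * Min P + int 1 * \<bar>w\<bar> \<in> B"
      using \<open>card B \<ge> 2\<close> by (subst Bw) (auto simp: ap_def)
    then obtain x y where xy: "x \<in> P" "y \<in> P" "4 * Min P + \<bar>w\<bar> = x + 3 * y"
      by (auto simp: B_def set_plus_def dilate_def)
    have dvd: "d' dvd x - Min P" if "x \<in> P" for x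
    proof -
      have "x \<in> ap (Min P) d' (card P)" using that P' by simp
      then show ?thesis by (auto simp: ap_def)
    qed
    have "\<bar>w\<bar> = (x - Min P) + 3 * (y - Min P)" using xy(3) by simp
    then have "d' dvd \<bar>w\<bar>" using dvd[OF xy(1)] dvd[OF xy(2)] by (metis dvd_add dvd_mult)
    then have "\<bar>w\<bar> = d'"
      using \<open>\<bar>w\<bar> dvd d'\<close> \<open>d' > 0\<close> by (simp add: zdvd_antisym_nonneg)
    then show ?thesis using P' w by blast
  qed
qed

text \<open>A progression may be read backwards, so its difference can be taken to be
  \<open>w\<close> with its sign, as \<open>extremal_ap\<close> requires.\<close>

lemma translate_imp_extremal:
  assumes "\<bar>w\<bar> = d" "P = ap u d (card P)"
    and "translate (dilate 3 Q) e = translate (dilate 3 P) w"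
  shows "extremal A"
proof -
  have "w \<noteq> 0"
  proof
    assume "w = 0"
    then have "dilate 3 P \<inter> dilate 3 P = {}" using disjoint[of P Q] assms(3) by simp
    then show False using neP by simp
  qed
  have "card P \<ge> 1" using finP neP by (simp add: Suc_le_eq card_gt_0_iff)
  have "\<exists>u. P = ap u w (card P)"
  proof (cases "w > 0")
    case True
    then show ?thesis using assms(1,2) by auto
  next
    case False
    then have "- d = w" using assms(1) by linarith
    then show ?thesis using assms(2) ap_reverse[OF \<open>card P \<ge> 1\<close>, of u d] by metis
  qed
  then obtain u' where "P = ap u' w (card P)" ..
  then show ?thesis
    using extremal_ap[OF \<open>card P \<ge> 1\<close> \<open>w \<noteq> 0\<close>, of u'] assms(3) by (simp add: A_def)
qed

section \<open>Exchanging the two classes and combining the bounds\<close>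

lemma swap: "two_classes Q P (- e)"
  using finP neP finQ neQ e by unfold_locales auto

text \<open>Translating by \<open>- e\<close> makes the \<open>Q\<close> part the class of multiples
  of 3, so each bound on \<open>P + A\<close> has a counterpart for \<open>Q + A\<close>.\<close>

lemma swap_A: "two_classes.A Q P (- e) = translate A (- e)"
  unfolding two_classes.A_def[OF swap] A_def by (simp add: translate_Un Un_commute)

lemma card_swap: "card (Q + two_classes.A Q P (- e)) = card (Q + A)"
  unfolding swap_A by (simp add: sumset_translate_right)

lemma full_nonfull_strict:
  assumes P: "full3 P" and Q: "\<not> full3 Q" and hQ: "4 * card Q \<le> card (Q + dilate 3 Q) + 4"
  shows "4 * card A < card (A + dilate 3 A) + 4"
proof -
  interpret swap: two_classes Q P "- e" by (rule swap)
  have p: "card P \<ge> 3" using full3_card_ge[OF finP P] .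
  have q: "card Q \<ge> 1" using finQ neQ by (simp add: Suc_le_eq card_gt_0_iff)
  note bounds = full_bound[OF P] swap.nonfull_bound[OF Q, unfolded card_swap] hQ p
  have "4 * card P + 4 * card Q < card (P + A) + card (Q + A) + 4"
  \<comment> \<open>The general bounds are strict for \<open>|P| \<ge> 4\<close>, and for
    \<open>|P| = 3\<close> once \<open>|Q| \<ge> 4\<close>. The few remaining sizes need the sharper
    bounds for \<open>Q + A\<close> or \<open>full_strict\<close>.\<close>
  proof (cases "card P = 3 \<and> card Q \<le> 3")
    case True
    with q consider "card Q = 1" | "card Q = 2" | "card Q = 3" by linarith
    then show ?thesis
    proof cases
      case 1
      then show ?thesis using swap.singleton_bound[unfolded card_swap] bounds True by simp
    next
      case 2
      have "4 \<le> card (Q + dilate 3 Q)" using hQ 2 by simp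
      from swap.pair_bound[OF 2 this, unfolded card_swap] have "card (Q + A) \<ge> 8"
      proof (elim disjE exE conjE)
        fix x w
        assume *: "card P + 2 + card (translate (dilate 3 Q) w \<union> translate (dilate 3 P) (- e))
            \<le> card (Q + A)"
        have "card (translate (dilate 3 P) (- e))
            \<le> card (translate (dilate 3 Q) w \<union> translate (dilate 3 P) (- e))"
          by (intro card_mono) (auto simp: finP finQ)
        then show ?thesis using * True by simp
      qed (use True in auto)
      then show ?thesis using bounds True 2 by simp
    next
      case 3
      then show ?thesis using full_strict[OF P] bounds True by simp
    qed
  next
    case False
    then consider "card P \<ge> 4" | "card P = 3" "card Q \<ge> 4" using p by linarith
    then show ?thesis by cases (use bounds in linarith)+
  qed
  then show ?thesis by (simp add: card_A card_sumset_A)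
qed

lemma nonfull_nonfull:
  assumes P: "\<not> full3 P" and Q: "\<not> full3 Q"
    and hP: "4 * card P \<le> card (P + dilate 3 P) + 4"
    and hQ: "4 * card Q \<le> card (Q + dilate 3 Q) + 4"
  shows "4 * card A \<le> card (A + dilate 3 A) + 4"
    and "4 * card A = card (A + dilate 3 A) + 4 \<Longrightarrow> extremal A"
proof -
  interpret swap: two_classes Q P "- e" by (rule swap)
  have pq: "card P \<ge> 1" "card Q \<ge> 1"
    using finP neP finQ neQ by (simp_all add: Suc_le_eq card_gt_0_iff)
  note bounds = nonfull_bound[OF P] swap.nonfull_bound[OF Q, unfolded card_swap] hP hQ
    singleton_bound swap.singleton_bound[unfolded card_swap]
  \<comment> \<open>The general bounds add up to \<open>5 * |A| - 8\<close>, which exceeds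
    \<open>4 * |A| - 4\<close> once \<open>|A| \<ge> 5\<close>. For sizes 1 and 3, the exact value
    for a singleton gives strictness.\<close>
  consider "card A = 2" | "card A = 3" | "card P = 2" "card Q = 2"
    | "card P = 1" "card Q = 3" | "card P = 3" "card Q = 1" | "card A \<ge> 5"
    using pq unfolding card_A by linarith
  then have "4 * card A \<le> card (A + dilate 3 A) + 4 \<and>
      (4 * card A = card (A + dilate 3 A) + 4 \<longrightarrow> extremal A)"
  proof cases
    case 1
    then have "card P = 1" "card Q = 1" using pq unfolding card_A by auto
    then show ?thesis using 1 extremal_card2 bounds by (simp add: card_sumset_A)
  next
    case 2
    then have "card P = 1 \<and> card Q = 2 \<or> card P = 2 \<and> card Q = 1" using pq unfolding card_A by auto
    then show ?thesis using 2 extremal_card3[of A] bounds by (auto simp: card_sumset_A)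
  next
    case 3
    \<comment> \<open>The value 6 excludes the first alternative of \<open>pair_bound\<close>. In
      the second, a union of two 2-element sets has at most 2 elements, so they coincide.\<close>
    have "extremal A" if "card (P + A) \<le> 6"
    proof -
      have "4 \<le> card (P + dilate 3 P)" "\<not> card Q + 5 \<le> card (P + A)"
        using hP 3 that by simp_all
      then obtain x w where xw: "w \<noteq> 0" "P = {x, x + w}"
        "card Q + 2 + card (translate (dilate 3 P) w \<union> translate (dilate 3 Q) e) \<le> card (P + A)"
        using pair_bound[OF 3(1)] by blast
      then have le: "card (translate (dilate 3 P) w \<union> translate (dilate 3 Q) e) \<le> 2"
        using 3 that by linarith
      let ?X = "translate (dilate 3 P) w" and ?Y = "translate (dilate 3 Q) e"
      have "?X = ?X \<union> ?Y" "?Y = ?X \<union> ?Y"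
        using le 3 finP finQ by (intro card_seteq; simp)+
      then have Q_eq: "?Y = ?X" by simp
      have P_eq: "P = ap x w 2" using xw(2) by (auto simp: ap_def numeral_2_eq_2 lessThan_Suc)
      from extremal_ap[of 2 w x] xw(1) show ?thesis
        unfolding A_def Q_eq P_eq[symmetric] by simp
    qed
    then show ?thesis using bounds 3 by (auto simp: card_A card_sumset_A)
  qed (use bounds in \<open>auto simp: card_A card_sumset_A\<close>)
  then show "4 * card A \<le> card (A + dilate 3 A) + 4"
    "4 * card A = card (A + dilate 3 A) + 4 \<Longrightarrow> extremal A" by auto
qed

lemma bound:
  assumes hP: "4 * card P \<le> card (P + dilate 3 P) + 4"
    and hQ: "4 * card Q \<le> card (Q + dilate 3 Q) + 4"
  shows "4 * card A \<le> card (A + dilate 3 A) + 4 \<and>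
    (4 * card A = card (A + dilate 3 A) + 4 \<longrightarrow> extremal A)"
proof -
  interpret swap: two_classes Q P "- e" by (rule swap)
  consider "full3 P" "full3 Q" | "full3 P" "\<not> full3 Q" | "\<not> full3 P" "full3 Q"
    | "\<not> full3 P" "\<not> full3 Q" by blast
  then show ?thesis
  proof cases
    case 1
    note bounds = full_bound[OF 1(1)] swap.full_bound[OF 1(2), unfolded card_swap]
    show ?thesis
    proof (cases "card P = card Q")
      case True
      have strict: "4 * card P \<le> card (P + A) + 2" "4 * card Q \<le> card (Q + A) + 2"
        using full_strict[OF 1(1) True] swap.full_strict[OF 1(2) True[symmetric], unfolded card_swap]
        by auto
      \<comment> \<open>The two losses of 2 add up to exactly 4, so equality for \<open>A\<close>
        forces equality for \<open>P\<close>.\<close>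
      have "extremal A" if "4 * card P = card (P + A) + 2"
        using full_tight_imp_translate[OF 1(1) True that] translate_imp_extremal by metis
      then show ?thesis using strict by (auto simp: card_A card_sumset_A)
    next
      case False
      \<comment> \<open>For the larger size \<open>q\<close> and the smaller size \<open>p\<close>,
        the bounds \<open>p + 3 * q - 3\<close> and \<open>4 * q - 3\<close> exceed the target by
        \<open>3 * (q - p) - 2 > 0\<close>.\<close>
      then have "4 * card A < card (A + dilate 3 A) + 4"
        using bounds unfolding card_A card_sumset_A neq_iff distrib_left by (elim disjE) linarith+
      then show ?thesis by simp
    qed
  next
    case 2
    then show ?thesis using full_nonfull_strict hQ by fastforce
  next
    case 3
    have "4 * card (translate A (- e))
        < card (translate A (- e) + dilate 3 (translate A (- e))) + 4"
      using swap.full_nonfull_strict[OF 3(2,1) hP] unfolding swap_A .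
    then show ?thesis
      by (simp add: dilate_translate sumset_translate_left sumset_translate_right)
  next
    case 4
    then show ?thesis using nonfull_nonfull hP hQ by blast
  qed
qed

end

section \<open>The sumset inequalities\<close>

lemma residue_class_eq:
  assumes "\<And>x. x \<in> X \<Longrightarrow> n dvd x - r"
  shows "X = translate (dilate n {y. n * y + r \<in> X}) r"
proof -
  have "\<exists>y. n * y + r \<in> X \<and> x = n * y + r" if x: "x \<in> X" for x
  proof -
    obtain y where "x - r = n * y" using assms[OF x] by (elim dvdE)
    then have "x = n * y + r" by simp
    then show ?thesis using x by blast
  qed
  then show ?thesis by (fastforce simp: translate_def dilate_def)
qed

lemma finite_residue_class: "finite X \<Longrightarrow> n \<noteq> 0 \<Longrightarrow> finite {y. n * y + r \<in> X}" for n :: int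
  using finite_vimageI[of X "\<lambda>y. n * y + r"] by (simp add: inj_def vimage_def)

text \<open>Sets contained in one residue class are rescaled, which shrinks the diameter.\<close>

lemma diameter_induct [consumes 2, case_names split rescale]:
  fixes X :: "int set" and n :: int
  assumes fin: "finite X" "X \<noteq> {}" and n: "n \<ge> 2"
    and split: "\<And>X. finite X \<Longrightarrow> \<not> (\<exists>r. \<forall>x\<in>X. n dvd x - r) \<Longrightarrow>
      (\<And>Y r. finite Y \<Longrightarrow> Y \<noteq> {} \<Longrightarrow> translate (dilate n Y) r \<subseteq> X \<Longrightarrow> R Y) \<Longrightarrow> R X"
    and single: "\<And>x. R {x}"
    and rescale: "\<And>X r. finite X \<Longrightarrow> X \<noteq> {} \<Longrightarrow> R X \<Longrightarrow> R (translate (dilate n X) r)"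
  shows "R X"
  using fin
proof (induction "nat (Max X - Min X)" arbitrary: X rule: less_induct)
  case less
  have sub: "R Y" if Y: "finite Y" "Y \<noteq> {}" "translate (dilate n Y) r \<subseteq> X"
    and "Min X < Max X" for Y r
  proof (rule less.hyps)
    have "Max Y \<in> Y" "Min Y \<in> Y" using Y by auto
    then have "n * Max Y + r \<in> X" "n * Min Y + r \<in> X"
      using Y(3) by (auto simp: translate_eq dilate_eq)
    then have "n * Max Y + r \<le> Max X" "Min X \<le> n * Min Y + r"
      using less.prems by auto
    \<comment> \<open>A copy of \<open>Y\<close> stretched by \<open>n\<close> fits into
      \<open>X\<close>, so the diameter at least halves.\<close>
    then have "n * (Max Y - Min Y) \<le> Max X - Min X" by (simp add: algebra_simps)
    moreover have "Max Y - Min Y \<ge> 0" using Y by simp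
    then have "2 * (Max Y - Min Y) \<le> n * (Max Y - Min Y)" using n by (rule mult_right_mono[rotated])
    ultimately have "2 * (Max Y - Min Y) \<le> Max X - Min X" by (rule order_trans[rotated])
    then have "Max Y - Min Y < Max X - Min X"
      using \<open>Max Y - Min Y \<ge> 0\<close> \<open>Min X < Max X\<close> unfolding right_diff_distrib by linarith
    then show "nat (Max Y - Min Y) < nat (Max X - Min X)"
      using \<open>Max Y - Min Y \<ge> 0\<close> by simp
  qed (use Y in auto)
  show ?case
  proof (cases "Min X < Max X")
    case False
    have "x = Min X" if "x \<in> X" for x
      using False Min_le[OF less.prems(1) that] Max_ge[OF less.prems(1) that] by linarith
    then have "X = {Min X}" using less.prems by auto
    then show ?thesis using single[of "Min X"] by simp
  next
    case True
    show ?thesis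
    proof (cases "\<exists>r. \<forall>x\<in>X. n dvd x - r")
      case False
      then show ?thesis using split less.prems sub True by blast
    next
      case ex: True
      then obtain r where "\<forall>x\<in>X. n dvd x - r" ..
      then have X: "X = translate (dilate n {y. n * y + r \<in> X}) r"
        by (intro residue_class_eq) auto
      define Y where "Y = {y. n * y + r \<in> X}"
      have X: "X = translate (dilate n Y) r" using X by (simp add: Y_def)
      have Y: "finite Y" "Y \<noteq> {}"
        using less.prems(1) n finite_residue_class[of X n r] less.prems(2)
        by (simp add: Y_def, metis X dilate_empty translate_empty)
      show ?thesis
        using rescale[OF Y sub[OF Y _ True]] X by (metis order_refl)
    qed
  qed
qed

lemma sumset_affine:
  "translate (dilate r X) c + dilate n (translate (dilate r X) c)
    = translate (dilate r (X + dilate n X)) (n * c + c)"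
  by (simp add: dilate_translate dilate_sumset sumset_translate_left sumset_translate_right
      mult.commute add.commute)

lemma card_sumset_affine:
  assumes "r \<noteq> 0"
  shows "card (translate (dilate r X) c + dilate n (translate (dilate r X) c))
    = card (X + dilate n X)"
  unfolding sumset_affine using assms by simp

text \<open>A set that meets all three classes loses only 3, so it is never an equality case. A set
  that meets two is a translate of the set \<open>A\<close> of the locale, with the inductive bounds
  available for \<open>P\<close> and \<open>Q\<close>. Rescaling preserves both claims.\<close>

lemma sumset_dilate_3:
  assumes "finite S" "S \<noteq> {}"
  shows "4 * card S \<le> card (S + dilate 3 S) + 4 \<and>
    (4 * card S = card (S + dilate 3 S) + 4 \<longrightarrow> extremal S)"
  using assms
proof (rule diameter_induct[where n = 3])
  fix X :: "int set"
  assume fin: "finite X" and multi: "\<not> (\<exists>r. \<forall>x\<in>X. 3 dvd x - r)"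
    and IH: "\<And>Y r. finite Y \<Longrightarrow> Y \<noteq> {} \<Longrightarrow> translate (dilate 3 Y) r \<subseteq> X \<Longrightarrow>
      4 * card Y \<le> card (Y + dilate 3 Y) + 4 \<and>
      (4 * card Y = card (Y + dilate 3 Y) + 4 \<longrightarrow> extremal Y)"
  have ne: "X \<noteq> {}" using multi by auto
  show "4 * card X \<le> card (X + dilate 3 X) + 4 \<and>
    (4 * card X = card (X + dilate 3 X) + 4 \<longrightarrow> extremal X)"
  proof (cases "full3 X")
    case True
    then show ?thesis using full3_card_sumset[OF fin True fin ne] by auto
  next
    case False
    then obtain i where i: "cls 3 1 X i \<noteq> {}" "cls 3 1 X (i + 1) = {}"
      using not_full3_cls[OF False ne, of 1] by auto
    have X: "X = cls 3 1 X i \<union> cls 3 1 X (i + 2)"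
      using Un_cls3[of 1 X i] i(2) by auto
    have "cls 3 1 X (i + 2) \<noteq> {}"
    proof
      assume "cls 3 1 X (i + 2) = {}"
      then have "\<forall>x\<in>X. 3 dvd x - i" using X by (auto simp: cls_def)
      then show False using multi by blast
    qed
    \<comment> \<open>The occupied classes are \<open>i\<close> and \<open>i + 2\<close>, so after
      translation by \<open>- i\<close> the offset is \<open>e = 2\<close>.\<close>
    define P Q where "P = {y. 3 * y + i \<in> cls 3 1 X i}"
      and "Q = {y. 3 * y + (i + 2) \<in> cls 3 1 X (i + 2)}"
    have P: "cls 3 1 X i = translate (dilate 3 P) i"
      and Q: "cls 3 1 X (i + 2) = translate (dilate 3 Q) (i + 2)"
      unfolding P_def Q_def by (intro residue_class_eq; simp add: cls_def)+
    have PQ: "finite P" "finite Q"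
      unfolding P_def Q_def using fin by (intro finite_residue_class; simp)+
    have PQ': "P \<noteq> {}" "Q \<noteq> {}"
      using i(1) \<open>cls 3 1 X (i + 2) \<noteq> {}\<close> P Q by auto
    interpret two_classes P Q 2
      using PQ PQ' by unfold_locales auto
    have XA: "X = translate A i"
      using X unfolding P Q by (simp add: A_def translate_Un add.commute)
    have "card A = card X" "card (X + dilate 3 X) = card (A + dilate 3 A)"
      unfolding XA using card_sumset_affine[of 1 A i 3] by simp_all
    moreover have "extremal A \<Longrightarrow> extremal X" unfolding XA by (rule extremal_translate)
    moreover have "4 * card P \<le> card (P + dilate 3 P) + 4"
      using IH[OF PQ(1) PQ'(1), of i] cls_subset[of 3 1 X i] unfolding P by blast
    moreover have "4 * card Q \<le> card (Q + dilate 3 Q) + 4"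
      using IH[OF PQ(2) PQ'(2), of "i + 2"] cls_subset[of 3 1 X "i + 2"] unfolding Q by blast
    ultimately show ?thesis using bound by simp
  qed
next
  fix X :: "int set" and r :: int
  assume "finite X" "X \<noteq> {}"
    and "4 * card X \<le> card (X + dilate 3 X) + 4 \<and>
      (4 * card X = card (X + dilate 3 X) + 4 \<longrightarrow> extremal X)"
  then show "4 * card (translate (dilate 3 X) r)
      \<le> card (translate (dilate 3 X) r + dilate 3 (translate (dilate 3 X) r)) + 4 \<and>
    (4 * card (translate (dilate 3 X) r)
      = card (translate (dilate 3 X) r + dilate 3 (translate (dilate 3 X) r)) + 4 \<longrightarrow>
      extremal (translate (dilate 3 X) r))"
    using extremal_translate extremal_dilate by (simp add: card_sumset_affine)
qed (simp_all add: sumset_singleton_left)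

section \<open>Arithmetic progressions and dilation by 2\<close>

lemma arithmetic_progression_iff: "arithmetic_progression X \<longleftrightarrow> (\<exists>u d k. k \<ge> 1 \<and> X = ap u d k)"
  by (simp add: arithmetic_progression_def ap_def image_def lessThan_def Bex_def conj_commute)

lemma arithmetic_progression_affine:
  assumes "arithmetic_progression X"
  shows "arithmetic_progression (translate (dilate r X) c)"
proof -
  obtain u d k where "k \<ge> 1" "X = ap u d k"
    using assms by (auto simp: arithmetic_progression_iff)
  then have "translate (dilate r X) c = ap (r * u + c) (r * d) k"
    by (simp add: ap_eq_affine dilate_translate)
  then show ?thesis using \<open>k \<ge> 1\<close> by (auto simp: arithmetic_progression_iff)
qed

text \<open>When both parities occur, each loses 1 in \<open>|?c i| + |X|\<close>, which gives the
  bound. Equality makes both sumsets tight: a class with two elements turns \<open>2 * X\<close>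
  into a progression, and otherwise \<open>X\<close> has just two points.\<close>

lemma sumset_dilate_2:
  assumes "finite S" "S \<noteq> {}"
  shows "3 * card S \<le> card (S + dilate 2 S) + 2 \<and>
    (3 * card S = card (S + dilate 2 S) + 2 \<longrightarrow> arithmetic_progression S)"
  using assms
proof (rule diameter_induct[where n = 2])
  fix X :: "int set"
  assume fin: "finite X" and multi: "\<not> (\<exists>r. \<forall>x\<in>X. 2 dvd x - r)"
  have "X \<noteq> {}" using multi by auto
  let ?c = "cls 2 1 X"
  have "\<exists>x\<in>X. \<not> 2 dvd x - 1" "\<exists>x\<in>X. \<not> 2 dvd x - 0"
    using multi by blast+
  then have ne: "?c 0 \<noteq> {}" "?c 1 \<noteq> {}"
    by (auto simp: cls_def)
  have card_X: "card X = card (?c 0) + card (?c 1)"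
    by (rule card_cls2[OF fin])
  have card_sum: "card (X + dilate 2 X) = card (?c 0 + dilate 2 X) + card (?c 1 + dilate 2 X)"
    using card_cls2[of "X + dilate 2 X"] fin by (simp add: cls_sumset_dilate finite_set_plus)
  have ge: "card (?c i) + card X \<le> card (?c i + dilate 2 X) + 1" if "?c i \<noteq> {}" for i
    using card_sumset_ge[OF _ that, of "dilate 2 X"] fin \<open>X \<noteq> {}\<close> by simp
  have "arithmetic_progression X" if tight: "3 * card X = card (X + dilate 2 X) + 2"
  proof (cases "\<exists>i\<in>{0, 1}. card (?c i) \<ge> 2")
    case True
    then obtain i where i: "i \<in> {0, 1}" "card (?c i) \<ge> 2" by blast
    have "card (?c i + dilate 2 X) + 1 = card (?c i) + card (dilate 2 X)"
      using ge[OF ne(1)] ge[OF ne(2)] card_X card_sum tight i(1) by auto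
    then obtain d where "d > 0" and "dilate 2 X = ap (Min (dilate 2 X)) d (card (dilate 2 X))"
      using tight_sumset_imp_ap[OF finite_cls[OF fin] i(2)] fin \<open>X \<noteq> {}\<close>
        finite_dilate dilate_empty by metis
    then have "dilate 2 X = ap (2 * Min X) d (card X)"
      using fin \<open>X \<noteq> {}\<close> by (simp add: Min_dilate)
    moreover have "card X \<ge> 2"
      using i(2) card_mono[OF fin cls_subset[of 2 1 X i]] by simp
    ultimately obtain d' where "X = ap (Min X) d' (card X)"
      by (auto elim: dilate_eq_ap[rotated 2])
    then show ?thesis
      using \<open>card X \<ge> 2\<close> unfolding arithmetic_progression_iff by (metis one_le_numeral order_trans)
  next
    case False
    moreover have "card (?c 0) \<ge> 1" "card (?c 1) \<ge> 1"
      using ne fin by (simp_all add: Suc_le_eq card_gt_0_iff)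
    ultimately have "card X = 2" using card_X by fastforce
    then obtain x y where "X = {x, y}" by (auto simp: card_2_iff)
    then have "X = ap x (y - x) 2" by (auto simp: ap_def numeral_2_eq_2 lessThan_Suc)
    then show ?thesis unfolding arithmetic_progression_iff by (metis one_le_numeral)
  qed
  then show "3 * card X \<le> card (X + dilate 2 X) + 2 \<and>
      (3 * card X = card (X + dilate 2 X) + 2 \<longrightarrow> arithmetic_progression X)"
    using ge[OF ne(1)] ge[OF ne(2)] card_X card_sum by simp
next
  fix x :: int
  have "{x} = ap x 0 1" by (simp add: ap_def lessThan_Suc)
  then have "arithmetic_progression {x}" unfolding arithmetic_progression_iff by blast
  then show "3 * card {x} \<le> card ({x} + dilate 2 {x}) + 2 \<and>
      (3 * card {x} = card ({x} + dilate 2 {x}) + 2 \<longrightarrow> arithmetic_progression {x})"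
    by (simp add: sumset_singleton_left dilate_eq)
qed (simp_all add: card_sumset_affine arithmetic_progression_affine)

section \<open>Sumsets of the extremal sets\<close>

text \<open>Below \<open>c * n\<close>, division by \<open>c\<close> gives the two summands, since
  the remainder is at most \<open>c - 1 \<le> n\<close>. From \<open>c * n\<close> on, the last
  translate of the interval is used.\<close>

lemma interval_sumset_dilate:
  fixes n c :: int
  assumes "n \<ge> 0" "c \<ge> 1" "c \<le> n + 1 \<or> n = 0"
  shows "{0..n} + dilate c {0..n} = {0..(c + 1) * n}"
proof (cases "n = 0")
  case True
  then show ?thesis by (simp add: sumset_singleton_left dilate_eq translate_eq)
next
  case False
  show ?thesis
  proof
    show "{0..n} + dilate c {0..n} \<subseteq> {0..(c + 1) * n}"
    proof
      fix z assume "z \<in> {0..n} + dilate c {0..n}"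
      then obtain x y where xy: "x \<in> {0..n}" "y \<in> {0..n}" "z = x + c * y"
        by (auto simp: set_plus_def dilate_eq)
      then have "c * y \<le> c * n" "0 \<le> c * y" using assms by (auto intro: mult_left_mono)
      then show "z \<in> {0..(c + 1) * n}" using xy by (simp add: distrib_right)
    qed
    show "{0..(c + 1) * n} \<subseteq> {0..n} + dilate c {0..n}"
    proof
      fix z assume z: "z \<in> {0..(c + 1) * n}"
      show "z \<in> {0..n} + dilate c {0..n}"
      proof (cases "z \<ge> c * n")
        case True
        then have "z - c * n \<in> {0..n}" using z by (simp add: distrib_right)
        moreover have "c * n \<in> dilate c {0..n}" using assms(1) by (auto simp: dilate_eq)
        ultimately show ?thesis using set_plus_intro[of "z - c * n" _ "c * n"] by simp
      next
        case less: False
        have "z mod c < c" "0 \<le> z mod c" using assms(2) by simp_all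
        then have "z mod c \<in> {0..n}" using assms(3) False by auto
        moreover have "c * (z div c) \<le> z"
          using mult_div_mod_eq[of c z] \<open>0 \<le> z mod c\<close> by linarith
        then have "c * (z div c) < c * n" using less by simp
        then have "z div c < n" using assms(2) by simp
        then have "c * (z div c) \<in> dilate c {0..n}"
          using z assms(2) by (auto simp: dilate_eq pos_imp_zdiv_nonneg_iff intro!: imageI)
        ultimately show ?thesis using set_plus_intro[of "z mod c" _ "c * (z div c)"] by simp
      qed
    qed
  qed
qed

lemma arithmetic_progression_sumset:
  assumes "arithmetic_progression A"
  shows "3 * card A = card (A + dilate 2 A) + 2"
proof -
  obtain u d k where k: "k \<ge> 1" and A: "A = ap u d k"
    using assms by (auto simp: arithmetic_progression_iff)
  then obtain n where n: "k = Suc n" by (cases k) auto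
  show ?thesis
  proof (cases "d = 0")
    case True
    then have "A = {u}" using A k by (simp add: ap_def image_constant_conv lessThan_empty_iff)
    then show ?thesis by (simp add: sumset_singleton_left dilate_eq)
  next
    case False
    have A': "A = translate (dilate d {0..int n}) u"
      unfolding A ap_eq_affine n int_image_lessThan ..
    have "2 \<le> int n + 1 \<or> int n = 0" by linarith
    then have "card (A + dilate 2 A) = card {0..3 * int n}"
      unfolding A' card_sumset_affine[OF False]
      using interval_sumset_dilate[of "int n" 2] by simp
    moreover have "card A = n + 1" using False by (simp add: A')
    ultimately show ?thesis by (simp add: nat_add_distrib nat_mult_distrib)
  qed
qed

lemma extremal_model_sumset:
  assumes "extremal_model A"
  shows "4 * card A = card (A + dilate 3 A) + 4"
  using assms unfolding extremal_model_def
proof (elim disjE exE conjE)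
  assume A: "A = {0, 1, 3}"
  have "A + dilate 3 A = {0, 1, 3, 4, 6, 9, 10, 12}"
    by (auto simp: A set_plus_def dilate_eq)
  then show ?thesis by (simp add: A)
next
  assume A: "A = {0, 1, 4}"
  have "A + dilate 3 A = {0, 1, 3, 4, 7, 12, 13, 16}"
    by (auto simp: A set_plus_def dilate_eq)
  then show ?thesis by (simp add: A)
next
  fix n :: int
  assume n: "n \<ge> 0" and A: "A = dilate 3 {0..n} \<union> translate (dilate 3 {0..n}) 1"
  interpret I: two_classes "{0..n}" "{0..n}" 1
    using n by unfold_locales auto
  have "{0..n} + dilate 3 {0..n} \<union> translate ({0..n} + dilate 3 {0..n}) 1 = {0..4 * n + 1}"
  \<comment> \<open>For \<open>n = 1\<close> the step 3 exceeds \<open>n + 1\<close> and the sumset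
    misses 2; the shifted copy fills this gap.\<close>
  proof (cases "n = 1")
    case True
    have "{0..1} = {0, 1::int}" by auto
    then have "{0..n} + dilate 3 {0..n} = {0, 1, 3, 4}"
      unfolding True by (auto simp: set_plus_def dilate_eq)
    moreover have "{0..5} = {0, 1, 2, 3, 4, 5::int}" by (simp add: set_eq_iff) presburger
    ultimately show ?thesis using True by (simp add: translate_eq) blast
  next
    case False
    then have "3 \<le> n + 1 \<or> n = 0" using n by linarith
    then have "{0..n} + dilate 3 {0..n} = {0..4 * n}"
      using interval_sumset_dilate[of n 3] n by simp
    moreover have "translate {0..4 * n} 1 = {1..4 * n + 1}"
      by (simp add: translate_eq)
    ultimately show ?thesis using n by (simp add: ivl_disj_un) force
  qed
  then have "card ({0..n} + I.A) = nat (4 * n + 2)"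
    by (simp add: I.PA_eq)
  moreover have "A = I.A" by (simp add: A I.A_def)
  ultimately show ?thesis
    using n by (simp add: I.card_A I.card_sumset_A nat_add_distrib nat_mult_distrib)
qed

lemma extremal_sumset:
  assumes "extremal A"
  shows "4 * card A = card (A + dilate 3 A) + 4"
proof -
  obtain B u v where "extremal_model B" "u \<noteq> 0" "A = translate (dilate u B) v"
    using assms by (auto simp: extremal_def affine_transform_iff)
  then show ?thesis using extremal_model_sumset[of B] by (simp add: card_sumset_affine)
qed

section \<open>Products in Baumslag-Solitar groups\<close>

text \<open>The action of \<open>BS(1,n)\<close> on the rationals by \<open>a: x \<mapsto> x + 1\<close> and \<open>b: x \<mapsto> x / n\<close> shows that
  \<open>a\<close> has infinite order.\<close>

fun letter_act :: "nat \<Rightarrow> bs_gen \<times> bool \<Rightarrow> rat \<Rightarrow> rat" where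
  "letter_act n (Gen_a, s) x = (if s then x + 1 else x - 1)"
| "letter_act n (Gen_b, s) x = (if s then x / of_nat n else x * of_nat n)"

lemma letter_act_funpow: "(letter_act n (Gen_a, True) ^^ k) x = x + of_nat k"
  by (induction k) auto

text \<open>The group relation is respected because \<open>x / n + 1 = (x + n) / n\<close>, and
  \<open>n > 0\<close> makes the action of \<open>b\<close> invertible.\<close>

lemma word_cong_imp_act_eq:
  assumes "word_cong (bs_relations n) u v" "n > 0"
  shows "foldr (letter_act n) u x = foldr (letter_act n) v x"
  using assms
proof (induction arbitrary: x rule: word_cong.induct)
  case (cancel g s)
  then show ?case by (cases g) auto
next
  case (relation u v)
  then show ?case by (auto simp: bs_relations_def letter_act_funpow field_simps)
qed auto

lemma bs_a_pow: "bs_a n [^]\<^bsub>BS n\<^esub> (k::nat) = word_class (bs_relations n) (replicate k (Gen_a, True))"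
proof (induction k)
  case 0
  show ?case by (simp add: BS_def one_presented_group)
next
  case (Suc k)
  then have "bs_a n [^]\<^bsub>BS n\<^esub> Suc k
      = word_class (bs_relations n) (replicate k (Gen_a, True) @ [(Gen_a, True)])"
    by (simp add: BS_def bs_a_def mult_presented_group)
  then show ?case by (simp add: replicate_append_same)
qed

lemma bs_a_pow_eq_one:
  assumes "n > 0" "bs_a n [^]\<^bsub>BS n\<^esub> (k::nat) = \<one>\<^bsub>BS n\<^esub>"
  shows "k = 0"
proof -
  have "word_cong (bs_relations n) (replicate k (Gen_a, True)) []"
    using assms(2) unfolding bs_a_pow by (simp add: BS_def one_presented_group word_class_eq_iff)
  \<comment> \<open>The word \<open>a^k\<close> sends 0 to \<open>k\<close>.\<close>
  from word_cong_imp_act_eq[OF this assms(1), of 0] show ?thesis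
    by (simp add: letter_act_funpow)
qed

lemma bs_a_int_pow_inj:
  assumes "n > 0"
  shows "inj (\<lambda>x::int. bs_a n [^]\<^bsub>BS n\<^esub> x)"
proof -
  interpret group "BS n" by (rule group_BS)
  have "x = y" if "bs_a n [^]\<^bsub>BS n\<^esub> x = bs_a n [^]\<^bsub>BS n\<^esub> y" "x \<le> y" for x y :: int
  proof -
    have "bs_a n [^]\<^bsub>BS n\<^esub> int (nat (y - x)) = \<one>\<^bsub>BS n\<^esub>"
      using that by (simp add: int_pow_diff bs_a_closed)
    then have "nat (y - x) = 0"
      unfolding int_pow_int by (rule bs_a_pow_eq_one[OF assms])
    then show ?thesis using that(2) by simp
  qed
  then show ?thesis by (metis injI linorder_linear)
qed

lemma (in group) int_pow_commute:
  assumes a: "a \<in> carrier G" and b: "b \<in> carrier G" and rel: "a \<otimes> b = b \<otimes> a [^] (n::nat)"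
  shows "a [^] (x::int) \<otimes> b = b \<otimes> a [^] (int n * x)"
proof -
  have nat: "a [^] k \<otimes> b = b \<otimes> a [^] (n * k)" for k :: nat
  proof (induction k)
    case 0
    show ?case using b by simp
  next
    case (Suc k)
    have "a [^] Suc k \<otimes> b = a [^] k \<otimes> (b \<otimes> a [^] n)"
      using a b by (simp add: m_assoc rel)
    also have "\<dots> = (b \<otimes> a [^] (n * k)) \<otimes> a [^] n"
      using a b by (simp add: m_assoc[symmetric] Suc)
    also have "\<dots> = b \<otimes> a [^] (n * Suc k)"
      using a b by (simp add: m_assoc nat_pow_mult add.commute)
    finally show ?case .
  qed
  show ?thesis
  proof (cases x rule: int_cases2)
    case (nonneg k)
    then show ?thesis using nat[of k] int_pow_int[of G a "n * k"] by (simp add: int_pow_int)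
  next
    case (nonpos k)
    \<comment> \<open>Negative exponents follow by moving the powers in the relation for
      \<open>k\<close> to the other sides.\<close>
    have "a [^] k \<otimes> (b \<otimes> inv (a [^] (n * k))) = b"
      using a b by (simp add: m_assoc[symmetric] nat) (simp add: m_assoc)
    then have "inv (a [^] k) \<otimes> b = b \<otimes> inv (a [^] (n * k))"
      using a b by (metis inv_solve_left' m_closed inv_closed nat_pow_closed)
    then show ?thesis
      using nonpos a int_pow_neg_int[of a "n * k"] by (simp add: int_pow_neg_int)
  qed
qed

section \<open>From products in the group to sumsets of integers\<close>

lemma ba_set_eq: "ba_set n A = (\<lambda>x. bs_b n \<otimes>\<^bsub>BS n\<^esub> (bs_a n [^]\<^bsub>BS n\<^esub> x)) ` A"
  by (auto simp: ba_set_def)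

lemma card_ba_set:
  assumes "n > 0"
  shows "card (ba_set n A) = card A"
proof -
  interpret group "BS n" by (rule group_BS)
  have "inj_on (\<lambda>x. bs_b n \<otimes>\<^bsub>BS n\<^esub> (bs_a n [^]\<^bsub>BS n\<^esub> x)) A"
    using bs_a_int_pow_inj[OF assms]
    by (auto simp: inj_on_def bs_a_closed bs_b_closed)
  then show ?thesis by (simp add: ba_set_eq card_image)
qed

text \<open>Moving \<open>a^x\<close> past \<open>b\<close> multiplies its exponent by
  \<open>n\<close>, so the products are the values of the injective map \<open>f\<close> on the
  sumset.\<close>

lemma card_ba_set_square:
  assumes "n > 0"
  shows "card (ba_set n A <#>\<^bsub>BS n\<^esub> ba_set n A) = card (A + dilate (int n) A)"
proof -
  interpret group "BS n" by (rule group_BS)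
  let ?a = "bs_a n" and ?b = "bs_b n"
  define f where "f z = ?b \<otimes>\<^bsub>BS n\<^esub> (?b \<otimes>\<^bsub>BS n\<^esub> (?a [^]\<^bsub>BS n\<^esub> z))" for z :: int
  have mult: "(?b \<otimes>\<^bsub>BS n\<^esub> ?a [^]\<^bsub>BS n\<^esub> x) \<otimes>\<^bsub>BS n\<^esub> (?b \<otimes>\<^bsub>BS n\<^esub> ?a [^]\<^bsub>BS n\<^esub> y) = f (y + int n * x)"
    for x y :: int
  proof -
    have "(?b \<otimes>\<^bsub>BS n\<^esub> ?a [^]\<^bsub>BS n\<^esub> x) \<otimes>\<^bsub>BS n\<^esub> (?b \<otimes>\<^bsub>BS n\<^esub> ?a [^]\<^bsub>BS n\<^esub> y)
        = ?b \<otimes>\<^bsub>BS n\<^esub> ((?a [^]\<^bsub>BS n\<^esub> x \<otimes>\<^bsub>BS n\<^esub> ?b) \<otimes>\<^bsub>BS n\<^esub> ?a [^]\<^bsub>BS n\<^esub> y)"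
      by (simp add: m_assoc bs_a_closed bs_b_closed)
    also have "\<dots> = f (y + int n * x)"
      using int_pow_commute[OF bs_a_closed bs_b_closed BS_relation, of x]
        int_pow_mult[OF bs_a_closed, of "int n * x" y]
      by (simp add: f_def m_assoc bs_a_closed bs_b_closed add.commute)
    finally show ?thesis .
  qed
  have "ba_set n A <#>\<^bsub>BS n\<^esub> ba_set n A = f ` (A + dilate (int n) A)"
    unfolding set_mult_def ba_set_eq
    by (force simp: mult set_plus_def dilate_eq)
  moreover have "inj f"
    using bs_a_int_pow_inj[OF assms]
    by (auto simp: inj_on_def f_def bs_a_closed bs_b_closed)
  ultimately show ?thesis by (simp add: card_image inj_on_subset)
qed

theorem theorem2:
  fixes A :: "int set"
  assumes "finite A"
  shows
    "(let S = ba_set 2 A; S2 = S <#>\<^bsub>BS 2\<^esub> S in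
        int (card S2) \<ge> 3 * int (card S) - 2 \<and>
        (int (card S2) = 3 * int (card S) - 2 \<longleftrightarrow> arithmetic_progression A)) \<and>
     (let S = ba_set 3 A; S2 = S <#>\<^bsub>BS 3\<^esub> S in
        int (card S2) \<ge> 4 * int (card S) - 4 \<and>
        (int (card S2) = 4 * int (card S) - 4 \<longleftrightarrow>
          extremal_model A \<or> (\<exists>B. extremal_model B \<and> affine_transform B A)))"
proof -
  have card: "card (ba_set 2 A) = card A" "card (ba_set 3 A) = card A"
    "card (ba_set 2 A <#>\<^bsub>BS 2\<^esub> ba_set 2 A) = card (A + dilate 2 A)"
    "card (ba_set 3 A <#>\<^bsub>BS 3\<^esub> ba_set 3 A) = card (A + dilate 3 A)"
    using card_ba_set[of 2 A] card_ba_set[of 3 A] card_ba_set_square[of 2 A]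
      card_ba_set_square[of 3 A] by simp_all
  \<comment> \<open>The bounds are moved to an additive form over the naturals, which avoids
    truncated subtraction.\<close>
  have int_card: "int l \<ge> 3 * int k - 2 \<longleftrightarrow> 3 * k \<le> l + 2"
    "int l = 3 * int k - 2 \<longleftrightarrow> 3 * k = l + 2"
    "int l \<ge> 4 * int k - 4 \<longleftrightarrow> 4 * k \<le> l + 4"
    "int l = 4 * int k - 4 \<longleftrightarrow> 4 * k = l + 4" for k l
    by linarith+
  have ext: "extremal_model A \<or> (\<exists>B. extremal_model B \<and> affine_transform B A) \<longleftrightarrow> extremal A"
    using extremal_model_imp_extremal by (auto simp: extremal_def)
  \<comment> \<open>If \<open>A\<close> is empty, equality would read \<open>0 = 2\<close>, and
    \<open>arithmetic_progression_sumset\<close> excludes the right side for the same reason. For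
    \<open>EX\<close> it is \<open>0 = 4\<close>.\<close>
  have AP: "3 * card A \<le> card (A + dilate 2 A) + 2 \<and>
      (3 * card A = card (A + dilate 2 A) + 2 \<longleftrightarrow> arithmetic_progression A)"
    using sumset_dilate_2[OF assms] arithmetic_progression_sumset[of A]
    by (cases "A = {}") auto
  have EX: "4 * card A \<le> card (A + dilate 3 A) + 4 \<and>
      (4 * card A = card (A + dilate 3 A) + 4 \<longleftrightarrow> extremal A)"
    using sumset_dilate_3[OF assms] extremal_sumset[of A]
    by (cases "A = {}") auto
  show ?thesis
    unfolding Let_def card int_card ext using AP EX by blast
qed

end
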